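(* Let $P,Q$ be distributions over $x=(x_1,\dots,x_d)\in\mathbb{R}^d$ with matching marginals (for each $i$, the law of $x_i$ under $P$ equals that under $Q$), with $\mathrm{Var}(x_i)>0$ for each $i$, and assume that under both $P$ and $Q$, for every $i,j\in[d]$ the pair $(x_i,x_j)$ has a two-dimensional Gaussian distribution. Let $\tilde x_i=(x_i-\mathbb{E}_P[x_i])\mathrm{Var}(x_i)^{-1/2}$ and $\tilde\Sigma_P=\mathbb{E}_P[\tilde x\tilde x^\top]$. Let $\mathcal{F}=\{\sum_{i=1}^d f_i(x_i): f_i:\mathbb{R}\to\mathbb{R},\ \mathbb{E}_P[f_i(x_i)^2]<\infty\ \forall i\}$. Then $$\tau(P,Q,\mathcal{F})\le \frac{d}{\lambda_{\min}(\tilde\Sigma_P)}.$$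
   Context: $\tau(P,Q,\mathcal{F})=\sup_{f,g\in\mathcal{F}}\mathbb{E}_Q[(f(x)-g(x))^2]/\mathbb{E}_P[(f(x)-g(x))^2]$ with the convention $0/0=0$. $\mathrm{Var}(x_i)$ is the variance of $x_i$ (the same under $P$ and $Q$). $\lambda_{\min}$ is the smallest eigenvalue; the bound is $+\infty$ if it is $0$. *)

theory Defs
  imports "HOL-Probability.Probability"
begin

definition gaussian_rv :: "'a measure \<Rightarrow> ('a \<Rightarrow> real) \<Rightarrow> bool" where
  "gaussian_rv M X \<longleftrightarrow>
     (\<exists>mu sigma. sigma > 0 \<and> distr M borel X = density lborel (normal_density mu sigma))
     \<or> (\<exists>c. distr M borel X = return borel c)"

definition bivariate_gaussian :: "'a measure \<Rightarrow> ('a \<Rightarrow> real) \<Rightarrow> ('a \<Rightarrow> real) \<Rightarrow> bool" where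
  "bivariate_gaussian M X Y \<longleftrightarrow> (\<forall>a b. gaussian_rv M (\<lambda>x. a * X x + b * Y x))"

definition lambda_min :: "real^'n^'n \<Rightarrow> real" where
  "lambda_min A = Min {l. \<exists>v. v \<noteq> 0 \<and> A *v v = l *\<^sub>R v}"

definition ratio0 :: "ennreal \<Rightarrow> ennreal \<Rightarrow> ennreal" where
  "ratio0 b a = (if a = 0 then (if b = 0 then 0 else \<infinity>) else b / a)"

definition tau :: "'a measure \<Rightarrow> 'a measure \<Rightarrow> ('a \<Rightarrow> real) set \<Rightarrow> ennreal" where
  "tau P Q F = (SUP fg \<in> F \<times> F.
      ratio0 (\<integral>\<^sup>+ x. ennreal ((fst fg x - snd fg x)^2) \<partial>Q)
             (\<integral>\<^sup>+ x. ennreal ((fst fg x - snd fg x)^2) \<partial>P))"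

definition additive_class :: "(real^'d) measure \<Rightarrow> (real^'d \<Rightarrow> real) set" where
  "additive_class P = {(\<lambda>x. \<Sum>i\<in>UNIV. f i (x $ i)) | f.
      \<forall>i. f i \<in> borel_measurable borel \<and>
          (\<integral>\<^sup>+ x. ennreal ((f i (x $ i))^2) \<partial>P) < \<infinity>}"

definition std_coord :: "(real^'d) measure \<Rightarrow> 'd \<Rightarrow> real^'d \<Rightarrow> real" where
  "std_coord P i x = (x $ i - prob_space.expectation P (\<lambda>y. y $ i))
                      / sqrt (prob_space.variance P (\<lambda>y. y $ i))"

definition std_cov :: "(real^'d) measure \<Rightarrow> real^'d^'d" where
  "std_cov P = (\<chi> i j. prob_space.expectation P (\<lambda>x. std_coord P i x * std_coord P j x))"

end

theory Submission
  imports Defs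
begin

text \<open>Only the marginals of \<open>Q\<close> enter: writing \<open>h = f - g\<close> as a sum of functions \<open>h i\<close> of single
  coordinates, Cauchy--Schwarz bounds \<open>Var_Q h\<close> by \<open>d\<close> times the sum of the variances of the
  summands. The heart of the matter is that \<open>Var_P h\<close> is at least \<open>lambda_min\<close> times the same sum.
  If every \<open>h i\<close> is a trigonometric polynomial, the characteristic function of the Gaussian pairs
  and the power series of \<open>exp (\<rho> s t)\<close> give
  \<open>E (h i * h j) = (\<Sum>k. \<rho> i j ^ k * a i k * cnj (a j k))\<close>, so it suffices that every Hadamard power
  of the correlation matrix, minus \<open>lambda_min\<close> times the identity, is positive semidefinite; as the
  diagonal of the correlation matrix is \<open>1\<close>, this follows by induction from Schur's product theorem.
  Trigonometric polynomials are dense in \<open>L\<^sup>2\<close> of any law on the line, and both sides are continuous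
  in \<open>L\<^sup>2\<close>. Finally \<open>lambda_min \<le> 1 \<le> d\<close> takes care of the means.\<close>

subsection \<open>Density of trigonometric polynomials\<close>

text \<open>Coefficient-frequency pairs are kept in a list with repetitions allowed, so that
  addition is concatenation and proofs go by list induction. With complex exponentials a product of
  two terms is again a single term.\<close>

definition trig_sum :: "(complex \<times> real) list \<Rightarrow> real \<Rightarrow> complex" where
  "trig_sum xs x = (\<Sum>(c, s)\<leftarrow>xs. c * cis (s * x))"

definition trig_poly :: "(real \<Rightarrow> real) \<Rightarrow> bool" where
  "trig_poly f \<longleftrightarrow> (\<exists>xs. \<forall>x. complex_of_real (f x) = trig_sum xs x)"

lemma trig_sum_simps [simp]:
  "trig_sum [] x = 0"
  "trig_sum ((c, s) # xs) x = c * cis (s * x) + trig_sum xs x"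
  "trig_sum (xs @ ys) x = trig_sum xs x + trig_sum ys x"
  by (simp_all add: trig_sum_def)

lemma trig_sum_mult_cis: "trig_sum (map (\<lambda>(d, t). (c * d, s + t)) ys) x = c * cis (s * x) * trig_sum ys x"
proof (induction ys)
  case (Cons a ys)
  obtain d t where a: "a = (d, t)" by fastforce
  have "cis ((s + t) * x) = cis (s * x) * cis (t * x)" by (simp add: cis_mult algebra_simps)
  then show ?case using Cons by (simp add: a algebra_simps)
qed simp

lemma trig_sum_mult: "\<exists>zs. \<forall>x. trig_sum zs x = trig_sum xs x * trig_sum ys x"
proof (induction xs)
  case Nil
  have "\<forall>x. trig_sum [] x = trig_sum [] x * trig_sum ys x" by simp
  then show ?case by blast
next
  case (Cons a xs)
  then obtain zs where zs: "\<And>x. trig_sum zs x = trig_sum xs x * trig_sum ys x" by blast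
  obtain c s where a: "a = (c, s)" by fastforce
  have "\<forall>x. trig_sum (map (\<lambda>(d, t). (c * d, s + t)) ys @ zs) x = trig_sum (a # xs) x * trig_sum ys x"
    by (simp add: a trig_sum_mult_cis zs distrib_right)
  then show ?case by blast
qed

lemma continuous_on_trig_sum: "continuous_on UNIV (trig_sum xs)"
proof (induction xs)
  case Nil
  have "trig_sum [] = (\<lambda>x. 0)" by auto
  then show ?case by simp
next
  case (Cons a xs)
  obtain c s where a: "a = (c, s)" by fastforce
  have "trig_sum (a # xs) = (\<lambda>x. c * cis (s * x) + trig_sum xs x)" by (auto simp: a)
  then show ?case using Cons by (auto intro!: continuous_intros)
qed

lemma trig_sum_bounded: "\<exists>B. \<forall>x. norm (trig_sum xs x) \<le> B"
proof (induction xs)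
  case Nil
  then show ?case by (auto intro: exI[of _ 0])
next
  case (Cons a xs)
  then obtain B where B: "\<And>x. norm (trig_sum xs x) \<le> B" by blast
  obtain c s where a: "a = (c, s)" by fastforce
  have "norm (trig_sum (a # xs) x) \<le> norm c + B" for x
    using norm_triangle_ineq[of "c * cis (s * x)" "trig_sum xs x"] B[of x] by (simp add: a norm_mult)
  then show ?case by blast
qed

lemma trig_sum_measurable [measurable]: "trig_sum xs \<in> borel_measurable borel"
  using continuous_on_trig_sum by (rule borel_measurable_continuous_onI)

lemma trig_poly_const [intro]: "trig_poly (\<lambda>x. c)"
  unfolding trig_poly_def by (rule exI[of _ "[(of_real c, 0)]"]) simp

lemma trig_poly_add [intro]:
  assumes "trig_poly f" "trig_poly g" shows "trig_poly (\<lambda>x. f x + g x)"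
proof -
  obtain xs ys where "\<And>x. complex_of_real (f x) = trig_sum xs x" "\<And>x. complex_of_real (g x) = trig_sum ys x"
    using assms unfolding trig_poly_def by auto
  then show ?thesis unfolding trig_poly_def by (intro exI[of _ "xs @ ys"]) simp
qed

lemma trig_poly_mult [intro]:
  assumes "trig_poly f" "trig_poly g" shows "trig_poly (\<lambda>x. f x * g x)"
proof -
  obtain xs ys where "\<And>x. complex_of_real (f x) = trig_sum xs x" "\<And>x. complex_of_real (g x) = trig_sum ys x"
    using assms unfolding trig_poly_def by auto
  then show ?thesis using trig_sum_mult[of xs ys] unfolding trig_poly_def by (metis of_real_mult)
qed

lemma trig_poly_sin: "trig_poly (\<lambda>x. sin (s * x))"
  unfolding trig_poly_def
  \<comment> \<open>Euler's formula: the sine is the difference of two conjugate exponentials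
    divided by \<open>2 * \<i>\<close>.\<close>
  by (rule exI[of _ "[(- \<i> / 2, s), (\<i> / 2, - s)]"]) (auto simp: complex_eq_iff)

text \<open>Trigonometric polynomials form an algebra containing the constants. The lemma is meant
  for a scaled sine inside a Weierstrass polynomial.\<close>

lemma trig_poly_real_polynomial:
  assumes "real_polynomial_function p" "trig_poly f" shows "trig_poly (\<lambda>x. p (f x))"
  using assms(1)
proof (induction rule: real_polynomial_function.induct)
  case (linear h)
  then obtain c where "h = (\<lambda>x. x * c)" using real_bounded_linear by auto
  then show ?case using assms(2) by auto
qed auto

lemma trig_poly_measurable:
  assumes "trig_poly f" shows "f \<in> borel_measurable borel"
proof -
  obtain xs where "\<And>x. complex_of_real (f x) = trig_sum xs x" using assms trig_poly_def by blast
  then have "f = (\<lambda>x. Re (trig_sum xs x))" by (metis Re_complex_of_real)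
  then show ?thesis by simp
qed

lemma trig_poly_bounded:
  assumes "trig_poly f" shows "\<exists>B. \<forall>x. \<bar>f x\<bar> \<le> B"
  using assms trig_sum_bounded unfolding trig_poly_def by (metis norm_of_real)

section \<open>Square-integrable functions on a probability space\<close>

text \<open>The two sides differ by the square of \<open>a - 2 * c + b\<close>. This replaces the
  triangle inequality for L2 distances, at the cost of a factor 2.\<close>

lemma power2_diff_le: "(a - b)\<^sup>2 \<le> 2 * (a - c)\<^sup>2 + 2 * (c - b :: real)\<^sup>2"
  using zero_le_power2[of "a - 2 * c + b"] by (simp add: power2_eq_square algebra_simps)

context prob_space begin

lemma integrable_bounded_power2:
  fixes f :: "'a \<Rightarrow> real"
  assumes "f \<in> borel_measurable M" "\<And>x. \<bar>f x\<bar> \<le> B"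
  shows "integrable M (\<lambda>x. (f x)\<^sup>2)"
proof (rule integrable_const_bound[of _ "B\<^sup>2"])
  show "AE x in M. norm ((f x)\<^sup>2) \<le> B\<^sup>2"
    using assms(2) by (intro always_eventually allI) (simp add: abs_le_square_iff[symmetric] order_trans[OF assms(2) abs_ge_self])
qed (use assms in measurable)

lemma integrable_power2_diff:
  fixes f g :: "'a \<Rightarrow> real"
  assumes [measurable]: "f \<in> borel_measurable M" "g \<in> borel_measurable M"
  and "integrable M (\<lambda>x. (f x)\<^sup>2)" "integrable M (\<lambda>x. (g x)\<^sup>2)"
  shows "integrable M (\<lambda>x. (f x - g x)\<^sup>2)"
proof (rule Bochner_Integration.integrable_bound)
  show "integrable M (\<lambda>x. 2 * (f x)\<^sup>2 + 2 * (g x)\<^sup>2)" using assms by auto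
  show "AE x in M. norm ((f x - g x)\<^sup>2) \<le> norm (2 * (f x)\<^sup>2 + 2 * (g x)\<^sup>2)"
    using power2_diff_le[of "f _" "g _" 0] by (intro always_eventually allI) simp
qed measurable

end

section \<open>The L2 closure of the trigonometric polynomials for a law on the line\<close>

text \<open>Integrability of the square is demanded explicitly, because the Bochner integral of a
  non-integrable function is 0 and would make the distance condition meaningless.\<close>

definition trig_approximable :: "real measure \<Rightarrow> (real \<Rightarrow> real) \<Rightarrow> bool" where
  "trig_approximable M h \<longleftrightarrow> h \<in> borel_measurable M \<and> integrable M (\<lambda>x. (h x)\<^sup>2) \<and>
     (\<forall>e>0. \<exists>g. trig_poly g \<and> (\<integral>x. (h x - g x)\<^sup>2 \<partial>M) < e)"

locale borel_prob = prob_space M for M :: "real measure" +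
  assumes sets_M [simp, measurable_cong]: "sets M = sets borel"
begin

lemma trig_poly_integrable_power2:
  assumes "trig_poly g" shows "g \<in> borel_measurable M" "integrable M (\<lambda>x. (g x)\<^sup>2)"
proof -
  show *: "g \<in> borel_measurable M" using trig_poly_measurable[OF assms] by measurable
  show "integrable M (\<lambda>x. (g x)\<^sup>2)"
    using trig_poly_bounded[OF assms] integrable_bounded_power2[OF *] by blast
qed

text \<open>A closure is closed: approximate \<open>h\<close> by some \<open>f\<close> and then
  \<open>f\<close> by a trigonometric polynomial.\<close>

lemma trig_approximable_limit:
  assumes h: "h \<in> borel_measurable M" "integrable M (\<lambda>x. (h x)\<^sup>2)"
    and f: "\<And>e. e > 0 \<Longrightarrow> \<exists>f. trig_approximable M f \<and> (\<integral>x. (h x - f x)\<^sup>2 \<partial>M) < e"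
  shows "trig_approximable M h"
  unfolding trig_approximable_def
proof (intro conjI allI impI h)
  fix e :: real assume e: "e > 0"
  \<comment> \<open>Each of the two errors is doubled by \<open>power2_diff_le\<close>, hence the
    quarter.\<close>
  then obtain f where f: "trig_approximable M f" "(\<integral>x. (h x - f x)\<^sup>2 \<partial>M) < e / 4"
    using assms(3)[of "e/4"] by auto
  then obtain g where g: "trig_poly g" "(\<integral>x. (f x - g x)\<^sup>2 \<partial>M) < e / 4"
    using e unfolding trig_approximable_def by (meson divide_pos_pos zero_less_numeral)
  note [measurable] = h(1) trig_poly_integrable_power2(1)[OF g(1)]
  have [measurable]: "f \<in> borel_measurable M" and [intro]: "integrable M (\<lambda>x. (f x)\<^sup>2)"
    using f unfolding trig_approximable_def by auto
  note [intro] = trig_poly_integrable_power2(2)[OF g(1)] h(2)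
  have "(\<integral>x. (h x - g x)\<^sup>2 \<partial>M) \<le> (\<integral>x. 2 * (h x - f x)\<^sup>2 + 2 * (f x - g x)\<^sup>2 \<partial>M)"
    by (intro integral_mono power2_diff_le Bochner_Integration.integrable_add integrable_mult_right integrable_power2_diff) auto
  also have "\<dots> = 2 * (\<integral>x. (h x - f x)\<^sup>2 \<partial>M) + 2 * (\<integral>x. (f x - g x)\<^sup>2 \<partial>M)"
    by (subst Bochner_Integration.integral_add) (auto intro!: integrable_power2_diff)
  also have "\<dots> < e" using f g by simp
  finally show "\<exists>g. trig_poly g \<and> (\<integral>x. (h x - g x)\<^sup>2 \<partial>M) < e" using g by blast
qed

lemma trig_approximable_trig_poly: "trig_poly g \<Longrightarrow> trig_approximable M g"
  unfolding trig_approximable_def using trig_poly_integrable_power2[of g] by (auto intro!: exI[of _ g])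

text \<open>Dominated convergence turns pointwise limits into L2 limits. The second bound by
  \<open>w\<close> makes \<open>h\<close> itself square integrable.\<close>

lemma trig_approximable_dominated_limit:
  assumes h: "h \<in> borel_measurable M" and f: "\<And>n::nat. trig_approximable M (f n)"
    and w: "integrable M w" and dom: "\<And>n x. (h x - f n x)\<^sup>2 \<le> w x" "\<And>x. (h x)\<^sup>2 \<le> w x"
    and lim: "\<And>x. (\<lambda>n. f n x) \<longlonglongrightarrow> h x"
  shows "trig_approximable M h"
proof (rule trig_approximable_limit)
  note [measurable] = h
  show "h \<in> borel_measurable M" by fact
  show "integrable M (\<lambda>x. (h x)\<^sup>2)"
    by (rule Bochner_Integration.integrable_bound[OF w])
       (auto intro!: always_eventually order_trans[OF dom(2) abs_ge_self])
  fix e :: real assume e: "e > 0"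
  have [measurable]: "\<And>n. f n \<in> borel_measurable M" using f by (auto simp: trig_approximable_def)
  have "(\<lambda>n. \<integral>x. (h x - f n x)\<^sup>2 \<partial>M) \<longlonglongrightarrow> (\<integral>x. 0 \<partial>M)"
  proof (rule integral_dominated_convergence[OF _ _ w])
    show "AE x in M. (\<lambda>n. (h x - f n x)\<^sup>2) \<longlonglongrightarrow> 0"
    proof (intro always_eventually allI)
      fix x
      have "(\<lambda>n. (h x - f n x)\<^sup>2) \<longlonglongrightarrow> (h x - h x)\<^sup>2" by (intro tendsto_intros lim)
      then show "(\<lambda>n. (h x - f n x)\<^sup>2) \<longlonglongrightarrow> 0" by simp
    qed
  qed (use dom in auto)
  then have "eventually (\<lambda>n. (\<integral>x. (h x - f n x)\<^sup>2 \<partial>M) < e) sequentially"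
    using e order_tendstoD(2) by fastforce
  then obtain n where "(\<integral>x. (h x - f n x)\<^sup>2 \<partial>M) < e" by (auto simp: eventually_sequentially)
  then show "\<exists>f. trig_approximable M f \<and> (\<integral>x. (h x - f x)\<^sup>2 \<partial>M) < e" using f by blast
qed

lemma trig_approximable_add:
  assumes "trig_approximable M f" "trig_approximable M g"
  shows "trig_approximable M (\<lambda>x. f x + g x)"
proof -
  note [measurable] = assms[unfolded trig_approximable_def, THEN conjunct1]
  note [intro] = assms[unfolded trig_approximable_def, THEN conjunct2, THEN conjunct1]
  show ?thesis unfolding trig_approximable_def
  proof (intro conjI allI impI)
    show "(\<lambda>x. f x + g x) \<in> borel_measurable M" by measurable
    have "integrable M (\<lambda>x. (f x - (- g x))\<^sup>2)" by (intro integrable_power2_diff) auto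
    then show "integrable M (\<lambda>x. (f x + g x)\<^sup>2)" by simp
    fix e :: real assume e: "e > 0"
    obtain u v where u: "trig_poly u" "(\<integral>x. (f x - u x)\<^sup>2 \<partial>M) < e / 4"
      and v: "trig_poly v" "(\<integral>x. (g x - v x)\<^sup>2 \<partial>M) < e / 4"
      using e assms unfolding trig_approximable_def by (meson divide_pos_pos zero_less_numeral)
    note [measurable] = trig_poly_integrable_power2(1)[OF u(1)] trig_poly_integrable_power2(1)[OF v(1)]
    note [intro] = trig_poly_integrable_power2(2)[OF u(1)] trig_poly_integrable_power2(2)[OF v(1)]
    have "(\<integral>x. (f x + g x - (u x + v x))\<^sup>2 \<partial>M) \<le> (\<integral>x. 2 * (f x - u x)\<^sup>2 + 2 * (g x - v x)\<^sup>2 \<partial>M)"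
    proof (rule integral_mono')
      show "integrable M (\<lambda>x. 2 * (f x - u x)\<^sup>2 + 2 * (g x - v x)\<^sup>2)"
        by (intro Bochner_Integration.integrable_add integrable_mult_right integrable_power2_diff) auto
      show "(f x + g x - (u x + v x))\<^sup>2 \<le> 2 * (f x - u x)\<^sup>2 + 2 * (g x - v x)\<^sup>2" for x
        using power2_diff_le[of "f x - u x" "- (g x - v x)" 0] by (simp add: algebra_simps)
    qed auto
    also have "\<dots> = 2 * (\<integral>x. (f x - u x)\<^sup>2 \<partial>M) + 2 * (\<integral>x. (g x - v x)\<^sup>2 \<partial>M)"
      by (subst Bochner_Integration.integral_add) (auto intro!: integrable_power2_diff)
    also have "\<dots> < e" using u v by simp
    finally show "\<exists>w. trig_poly w \<and> (\<integral>x. (f x + g x - w x)\<^sup>2 \<partial>M) < e" using u v by blast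
  qed
qed

lemma trig_approximable_cmult:
  assumes "trig_approximable M f" shows "trig_approximable M (\<lambda>x. c * f x)"
proof -
  note [measurable] = assms[unfolded trig_approximable_def, THEN conjunct1]
  note [intro] = assms[unfolded trig_approximable_def, THEN conjunct2, THEN conjunct1]
  show ?thesis unfolding trig_approximable_def
  proof (intro conjI allI impI)
    show "(\<lambda>x. c * f x) \<in> borel_measurable M" by measurable
    show "integrable M (\<lambda>x. (c * f x)\<^sup>2)" by (auto simp: power_mult_distrib)
    fix e :: real assume e: "e > 0"
    \<comment> \<open>The summand 1 keeps the denominator positive when
      \<open>c = 0\<close>.\<close>
    have "e / (c\<^sup>2 + 1) > 0" using e by (simp add: add_nonneg_pos)
    then obtain u where u: "trig_poly u" "(\<integral>x. (f x - u x)\<^sup>2 \<partial>M) < e / (c\<^sup>2 + 1)"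
      using assms unfolding trig_approximable_def by blast
    have "(\<integral>x. (c * f x - c * u x)\<^sup>2 \<partial>M) = c\<^sup>2 * (\<integral>x. (f x - u x)\<^sup>2 \<partial>M)"
      by (simp flip: integral_mult_right_zero power_mult_distrib right_diff_distrib)
    also have "\<dots> \<le> (c\<^sup>2 + 1) * (\<integral>x. (f x - u x)\<^sup>2 \<partial>M)"
      by (intro mult_right_mono) auto
    also have "\<dots> < e" using u(2) by (simp add: pos_less_divide_eq add_nonneg_pos mult.commute)
    finally show "\<exists>w. trig_poly w \<and> (\<integral>x. (c * f x - w x)\<^sup>2 \<partial>M) < e"
      using u trig_poly_mult[OF trig_poly_const[of c]] by blast
  qed
qed

text \<open>\<open>f (n sin (x / n))\<close> converges to \<open>f x\<close>, and by Weierstrass it is uniformly close to a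
  polynomial in \<open>sin (x / n)\<close>.\<close>

lemma trig_approximable_continuous:
  assumes cont: "continuous_on UNIV f" and C: "\<And>x. \<bar>f x\<bar> \<le> C"
  shows "trig_approximable M f"
proof -
  \<comment> \<open>The successor keeps the scale positive at \<open>n = 0\<close> and gives
    \<open>1 / a n \<le> 1\<close>.\<close>
  define a where "a n = real (Suc n)" for n
  have a: "a n > 0" for n by (simp add: a_def)
  have "\<exists>p. real_polynomial_function p \<and> (\<forall>x\<in>{- a n..a n}. \<bar>f x - p x\<bar> < 1 / a n)" for n
    by (rule Stone_Weierstrass_real_polynomial_function[of "{- a n..a n}" f "1 / a n"])
       (use a cont in \<open>auto intro: continuous_on_subset\<close>)
  then obtain p where p: "\<And>n. real_polynomial_function (p n)"
    "\<And>n x. x \<in> {- a n..a n} \<Longrightarrow> \<bar>f x - p n x\<bar> < 1 / a n" by metis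
  \<comment> \<open>For every real \<open>x\<close> the value \<open>y n x\<close> lies in the
    interval where \<open>p n\<close> is close to \<open>f\<close>, so the Weierstrass estimate
    holds on the whole line after composition.\<close>
  define y where "y n x = a n * sin (1 / a n * x)" for n x
  have y: "y n x \<in> {- a n..a n}" for n x
  proof -
    have "\<bar>y n x\<bar> \<le> a n * 1" unfolding y_def abs_mult using a[of n] by (intro mult_mono) auto
    then show ?thesis by auto
  qed
  have tp: "trig_poly (\<lambda>x. p n (y n x))" for n
    unfolding y_def
    by (rule trig_poly_real_polynomial[OF p(1) trig_poly_mult[OF trig_poly_const trig_poly_sin]])
  have close: "\<bar>f (y n x) - p n (y n x)\<bar> < 1 / a n" for n x using p(2) y by blast
  \<comment> \<open>One \<open>C\<close> for each of \<open>f x\<close> and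
    \<open>f (y n x)\<close>, and 1 for the polynomial error.\<close>
  have bnd: "\<bar>f x - p n (y n x)\<bar> \<le> 2 * C + 1" for n x
  proof -
    have "1 / a n \<le> 1" by (simp add: a_def)
    then show ?thesis using C[of x] C[of "y n x"] close[of n x] by linarith
  qed
  have C0: "C \<ge> 0" using C[of 0] by linarith
  have lim_a: "(\<lambda>n. 1 / a n) \<longlonglongrightarrow> 0" unfolding a_def using LIMSEQ_inverse_real_of_nat by (simp add: inverse_eq_divide)
  have lim_y: "(\<lambda>n. y n x) \<longlonglongrightarrow> x" for x
  proof (cases "x = 0")
    case False
    \<comment> \<open>This quotient is the difference quotient of the sine at 0.\<close>
    have "((\<lambda>t. sin t / t) \<longlongrightarrow> 1) (at (0::real))"
      using DERIV_sin[of "0::real"] by (simp add: DERIV_def)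
    moreover have "filterlim (\<lambda>n. 1 / a n * x) (at 0) sequentially"
      unfolding filterlim_at using tendsto_mult_left_zero[OF lim_a, of x] False a
      by (auto simp: less_imp_neq[OF a, symmetric])
    ultimately have "(\<lambda>n. sin (1 / a n * x) / (1 / a n * x)) \<longlonglongrightarrow> 1"
      by (rule filterlim_compose)
    then have "(\<lambda>n. x * (sin (1 / a n * x) / (1 / a n * x))) \<longlonglongrightarrow> x * 1"
      by (intro tendsto_intros)
    then show ?thesis using False by (simp add: y_def mult.commute)
  qed (simp add: y_def)
  show ?thesis
  proof (rule trig_approximable_dominated_limit)
    show "f \<in> borel_measurable M" using borel_measurable_continuous_onI[OF cont] by measurable
    show "trig_approximable M (\<lambda>x. p n (y n x))" for n using tp trig_approximable_trig_poly by blast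
    show "integrable M (\<lambda>x. (2 * C + 1)\<^sup>2)" by simp
    show "(f x - p n (y n x))\<^sup>2 \<le> (2 * C + 1)\<^sup>2" for n x
      using bnd[of x n] by (simp add: abs_le_square_iff[symmetric])
    show "(f x)\<^sup>2 \<le> (2 * C + 1)\<^sup>2" for x
      using C[of x] by (simp add: abs_le_square_iff[symmetric])
    fix x
    have "(\<lambda>n. f (y n x)) \<longlonglongrightarrow> f x"
      by (rule continuous_on_tendsto_compose[OF cont lim_y]) auto
    moreover have "(\<lambda>n. f (y n x) - p n (y n x)) \<longlonglongrightarrow> 0"
      by (rule tendsto_rabs_zero_cancel, rule tendsto_sandwich[OF _ _ tendsto_const lim_a])
         (use close in \<open>auto intro: always_eventually less_imp_le\<close>)
    ultimately have "(\<lambda>n. f (y n x) - (f (y n x) - p n (y n x))) \<longlonglongrightarrow> f x - 0"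
      by (rule tendsto_diff)
    then show "(\<lambda>n. p n (y n x)) \<longlonglongrightarrow> f x" by simp
  qed
qed

text \<open>The indicator is the pointwise limit of continuous functions that are 1 on
  \<open>K\<close> and fall off with slope \<open>n\<close> in the distance to \<open>K\<close>. The
  empty set is excluded since \<open>infdist x {} = 0\<close>, which would make all of them
  1.\<close>

lemma trig_approximable_indicator_closed:
  assumes "closed K" "K \<noteq> {}" shows "trig_approximable M (indicat_real K)"
proof -
  define f where "f n x = max 0 (1 - real n * infdist x K)" for n x
  have f01: "0 \<le> f n x" "f n x \<le> 1" for n x
    by (auto simp: f_def infdist_nonneg)
  show ?thesis
  proof (rule trig_approximable_dominated_limit)
    show "indicat_real K \<in> borel_measurable M" using borel_closed[OF assms(1)] by (intro borel_measurable_indicator) simp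
    show "trig_approximable M (f n)" for n
      by (rule trig_approximable_continuous[of _ 1])
         (use f01 in \<open>auto simp: f_def intro!: continuous_intros\<close>)
    show "integrable M (\<lambda>x. 1 :: real)" by simp
    have "\<bar>indicat_real K x - f n x\<bar> \<le> \<bar>1\<bar>" for n x using f01[of n x] by (auto simp: indicator_def)
    then show "(indicat_real K x - f n x)\<^sup>2 \<le> 1" for n x by (metis abs_le_square_iff power_one)
    show "(indicat_real K x)\<^sup>2 \<le> 1" for x by (auto simp: indicator_def)
    fix x
    show "(\<lambda>n. f n x) \<longlonglongrightarrow> indicat_real K x"
    proof (cases "x \<in> K")
      case True
      then show ?thesis by (simp add: f_def)
    next
      case False
      then have pos: "infdist x K > 0"
        using assms infdist_pos_not_in_closed by blast
      then obtain N :: nat where N: "1 < real N * infdist x K"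
        using ex_less_of_nat_mult by blast
      have "f n x = 0" if "n \<ge> N" for n
      proof -
        have "real N * infdist x K \<le> real n * infdist x K" using that pos by simp
        then show ?thesis using N by (simp add: f_def)
      qed
      then have "eventually (\<lambda>n. f n x = 0) sequentially" by (auto simp: eventually_sequentially)
      then show ?thesis using False by (simp add: tendsto_eventually)
    qed
  qed
qed

text \<open>Inner regularity gives a compact \<open>K\<close> inside \<open>B\<close> that misses
  little mass, and the squared L2 distance of the indicators is the measure of
  \<open>B - K\<close>.\<close>

lemma trig_approximable_indicator:
  assumes B: "B \<in> sets M" shows "trig_approximable M (indicat_real B)"
proof (rule trig_approximable_limit)
  show m: "indicat_real B \<in> borel_measurable M" using B by simp
  show "integrable M (\<lambda>x. (indicat_real B x)\<^sup>2)"
    by (rule integrable_bounded_power2[OF m, of 1]) (auto simp: indicator_def)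
  fix e :: real assume e: "e > 0"
  have zero: "trig_approximable M (indicat_real {})"
    using trig_approximable_trig_poly[OF trig_poly_const[of 0]] by (simp add: indicator_def[abs_def])
  obtain K where K: "K \<subseteq> B" "compact K" "measure M B < measure M K + e"
  \<comment> \<open>For large \<open>e\<close> the number \<open>ennreal (measure M B - e)\<close>
    is 0, so the strict inequality used with inner regularity needs positive measure. A null set is
    approximated by the empty set.\<close>
  proof (cases "measure M B = 0")
    case True
    then show ?thesis using e that[of "{}"] by simp
  next
    case False
    then have "ennreal (measure M B - e) < emeasure M B"
      using e by (simp add: emeasure_eq_measure ennreal_less_iff zero_less_measure_iff ennreal_lessI)
    also have "emeasure M B = (SUP K\<in>{K. K \<subseteq> B \<and> compact K}. emeasure M K)"
      using B by (intro inner_regular) auto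
    finally obtain K where K: "K \<subseteq> B" "compact K" "ennreal (measure M B - e) < emeasure M K"
      by (auto simp: less_SUP_iff)
    then have "measure M B - e < measure M K"
      by (metis emeasure_eq_measure ennreal_leI not_le)
    then show ?thesis using K that by simp
  qed
  then have Km: "K \<in> sets M" using borel_closed[OF compact_imp_closed] by simp
  have "trig_approximable M (indicat_real K)"
    using trig_approximable_indicator_closed[of K] zero compact_imp_closed[OF K(2)] by (cases "K = {}") auto
  moreover have "(\<integral>x. (indicat_real B x - indicat_real K x)\<^sup>2 \<partial>M) < e"
  proof -
    have "(\<integral>x. (indicat_real B x - indicat_real K x)\<^sup>2 \<partial>M) = (\<integral>x. indicat_real (B - K) x \<partial>M)"
      using K(1) by (intro Bochner_Integration.integral_cong) (auto simp: indicator_def)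
    also have "\<dots> = measure M (B - K)" using sets_eq_imp_space_eq[OF sets_M] by simp
    also have "\<dots> = measure M B - measure M K" by (intro measure_Diff B Km K)  simp
    also have "\<dots> < e" using K(3) by simp
    finally show ?thesis .
  qed
  ultimately show "\<exists>f. trig_approximable M f \<and> (\<integral>x. (indicat_real B x - f x)\<^sup>2 \<partial>M) < e" by blast
qed

text \<open>Induction from indicators through sums and increasing limits. Square integrability stays
  a premise inside the induction, as it passes from a sum or a limit down to the smaller nonnegative
  functions.\<close>

lemma trig_approximable_nonneg:
  assumes "h \<in> borel_measurable M" "\<And>x. 0 \<le> h x" "integrable M (\<lambda>x. (h x)\<^sup>2)"
  shows "trig_approximable M h"
proof -
  have "integrable M (\<lambda>x. (h x)\<^sup>2) \<longrightarrow> trig_approximable M h"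
    using assms(1,2)
  proof (induction h rule: borel_measurable_induct_real)
    case (set A)
    then show ?case using trig_approximable_indicator by blast
  next
    case (mult u c)
    show ?case
    \<comment> \<open>For \<open>c = 0\<close> the premise on \<open>c * u\<close> says nothing
      about \<open>u\<close>, so the induction hypothesis is out of reach.\<close>
    proof (cases "c = 0")
      case True
      then show ?thesis using trig_approximable_trig_poly[OF trig_poly_const[of 0]] by simp
    next
      case False
      then show ?thesis using mult trig_approximable_cmult by (auto simp: power_mult_distrib)
    qed
  next
    case (add u v)
    have [measurable]: "u \<in> borel_measurable M" "v \<in> borel_measurable M" using add by auto
    have nn: "u x \<ge> 0" "v x \<ge> 0" for x using add by auto
    have "integrable M (\<lambda>x. (u x)\<^sup>2)" "integrable M (\<lambda>x. (v x)\<^sup>2)"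
      if i: "integrable M (\<lambda>x. (v x + u x)\<^sup>2)"
      by (rule Bochner_Integration.integrable_bound[OF i]; simp add: nn power_mono)+
    then show ?case using add trig_approximable_add by blast
  next
    case (seq U)
    show ?case
    proof
      assume i: "integrable M (\<lambda>x. (h x)\<^sup>2)"
      have sp: "x \<in> space M" for x using sets_eq_imp_space_eq[OF sets_M] by simp
      have le: "U n x \<le> h x" for n x
      proof (rule incseq_le)
        show "incseq (\<lambda>n. U n x)" using \<open>incseq U\<close> by (auto simp: incseq_def intro: le_funD)
      qed (simp add: seq(4) sp)
      have sq: "(U n x)\<^sup>2 \<le> (h x)\<^sup>2" for n x using le seq(2) by (intro power_mono) auto
      note [measurable] = seq(1)
      show "trig_approximable M h"
      proof (rule trig_approximable_dominated_limit[OF assms(1) _ i])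
        show "trig_approximable M (U n)" for n
        proof (rule seq.IH[THEN mp])
          show "integrable M (\<lambda>x. (U n x)\<^sup>2)"
            by (rule Bochner_Integration.integrable_bound[OF i]) (simp_all add: sq)
        qed
        show "(h x - U n x)\<^sup>2 \<le> (h x)\<^sup>2" for n x
          using le[of n x] seq(2)[of n x] by (intro power_mono) auto
        show "(\<lambda>n. U n x) \<longlonglongrightarrow> h x" for x by (simp add: seq(4) sp)
      qed simp
    qed
  qed
  then show ?thesis using assms by blast
qed

theorem trig_approximable:
  assumes h: "h \<in> borel_measurable M" "integrable M (\<lambda>x. (h x)\<^sup>2)"
  shows "trig_approximable M h"
proof -
  note [measurable] = h(1)
  have "trig_approximable M (\<lambda>x. max 0 (h x))" "trig_approximable M (\<lambda>x. max 0 (- h x))"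
    by (rule trig_approximable_nonneg; use h in \<open>auto intro!: Bochner_Integration.integrable_bound[OF h(2)] simp: max_def\<close>)+
  then have "trig_approximable M (\<lambda>x. max 0 (h x) + - 1 * max 0 (- h x))"
    by (intro trig_approximable_add trig_approximable_cmult)
  moreover have "(\<lambda>x. max 0 (h x) + - 1 * max 0 (- h x)) = h" by (auto simp: max_def)
  ultimately show ?thesis by simp
qed

end

subsection \<open>Covariances of trigonometric polynomials of Gaussian pairs\<close>

text \<open>The coefficients, up to a factor \<open>\<i> ^ k\<close>, of \<open>trig_sum xs\<close> with respect to the
  orthonormal Hermite polynomials.\<close>

definition trig_coeff :: "(complex \<times> real) list \<Rightarrow> nat \<Rightarrow> complex" where
  "trig_coeff xs k = (\<Sum>(c, s)\<leftarrow>xs. c * of_real (exp (- s\<^sup>2 / 2) * s ^ k / sqrt (fact k)))"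

lemma trig_coeff_simps [simp]:
  "trig_coeff [] k = 0"
  "trig_coeff ((c, s) # xs) k = c * of_real (exp (- s\<^sup>2 / 2) * s ^ k / sqrt (fact k)) + trig_coeff xs k"
  by (simp_all add: trig_coeff_def)

text \<open>Power series of \<open>exp (r * s * t)\<close>, with \<open>1 / fact k\<close> split
  evenly between the two variables. The sum is the expectation of \<open>cis (s * X - t * Y)\<close>
  for a centred Gaussian pair with unit variances and covariance \<open>r\<close>.\<close>

lemma gauss_kernel_sums:
  fixes s t r :: real
  shows "(\<lambda>k. complex_of_real (r ^ k) * of_real (exp (- s\<^sup>2 / 2) * s ^ k / sqrt (fact k))
              * of_real (exp (- t\<^sup>2 / 2) * t ^ k / sqrt (fact k)))
         sums complex_of_real (exp (- (s\<^sup>2 - 2 * r * s * t + t\<^sup>2) / 2))"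
proof -
  have "(\<lambda>k. exp (- s\<^sup>2 / 2) * exp (- t\<^sup>2 / 2) * ((r * s * t) ^ k /\<^sub>R fact k))
          sums (exp (- s\<^sup>2 / 2) * exp (- t\<^sup>2 / 2) * exp (r * s * t))"
    by (intro sums_mult exp_converges)
  moreover have "exp (- s\<^sup>2 / 2) * exp (- t\<^sup>2 / 2) * exp (r * s * t) = exp (- (s\<^sup>2 - 2 * r * s * t + t\<^sup>2) / 2)"
    unfolding exp_add[symmetric] by (rule arg_cong[of _ _ exp]) (simp add: field_simps)
  moreover have "exp (- s\<^sup>2 / 2) * exp (- t\<^sup>2 / 2) * ((r * s * t) ^ k /\<^sub>R fact k)
      = r ^ k * (exp (- s\<^sup>2 / 2) * s ^ k / sqrt (fact k)) * (exp (- t\<^sup>2 / 2) * t ^ k / sqrt (fact k))" for k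
  proof -
    have "sqrt (fact k) * sqrt (fact k) = (fact k :: real)" by simp
    then show ?thesis by (simp add: power_mult_distrib divide_simps)
  qed
  ultimately have "(\<lambda>k. r ^ k * (exp (- s\<^sup>2 / 2) * s ^ k / sqrt (fact k)) * (exp (- t\<^sup>2 / 2) * t ^ k / sqrt (fact k)))
      sums exp (- (s\<^sup>2 - 2 * r * s * t + t\<^sup>2) / 2)" by simp
  then have "(\<lambda>k. complex_of_real (r ^ k * (exp (- s\<^sup>2 / 2) * s ^ k / sqrt (fact k)) * (exp (- t\<^sup>2 / 2) * t ^ k / sqrt (fact k))))
      sums complex_of_real (exp (- (s\<^sup>2 - 2 * r * s * t + t\<^sup>2) / 2))" by (rule sums_of_real)
  then show ?thesis by (simp only: of_real_mult)
qed

context prob_space begin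

lemma integrable_mult_square_integrable:
  fixes f g :: "'a \<Rightarrow> real"
  assumes [measurable]: "f \<in> borel_measurable M" "g \<in> borel_measurable M"
    and "integrable M (\<lambda>x. (f x)\<^sup>2)" "integrable M (\<lambda>x. (g x)\<^sup>2)"
  shows "integrable M (\<lambda>x. f x * g x)"
proof (rule Bochner_Integration.integrable_bound)
  show "integrable M (\<lambda>x. (f x)\<^sup>2 + (g x)\<^sup>2)" using assms by auto
  show "AE x in M. norm (f x * g x) \<le> norm ((f x)\<^sup>2 + (g x)\<^sup>2)"
  proof (intro always_eventually allI)
    fix x
    have "2 * \<bar>f x\<bar> * \<bar>g x\<bar> \<le> \<bar>f x\<bar>\<^sup>2 + \<bar>g x\<bar>\<^sup>2" by (rule sum_squares_bound)
    moreover have "0 \<le> \<bar>f x\<bar> * \<bar>g x\<bar>" by simp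
    ultimately show "norm (f x * g x) \<le> norm ((f x)\<^sup>2 + (g x)\<^sup>2)"
      unfolding real_norm_def abs_mult power2_abs by linarith
  qed
qed measurable

lemma integrable_trig_sum_mult:
  assumes [measurable]: "X \<in> borel_measurable M" "Y \<in> borel_measurable M"
  shows "integrable M (\<lambda>x. trig_sum xs (X x) * cnj (trig_sum ys (Y x)))"
proof -
  obtain B C where B: "\<And>x. norm (trig_sum xs x) \<le> B" and C: "\<And>x. norm (trig_sum ys x) \<le> C"
    using trig_sum_bounded by meson
  have "norm (trig_sum xs (X x) * cnj (trig_sum ys (Y x))) \<le> B * C" for x
    unfolding norm_mult using B C order_trans[OF norm_ge_zero B]
    by (intro mult_mono) auto
  then show ?thesis
    by (intro integrable_const_bound[of _ "B * C"] borel_measurable_times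
          measurable_compose[OF _ borel_measurable_continuous_onI[OF continuous_on_cnj[OF continuous_on_id]]]) auto
qed

text \<open>Both sides are additive in each of the two lists, so two inductions reduce the claim to
  a single pair of frequencies, which is \<open>gauss_kernel_sums\<close>. Gaussianity enters only
  through the characteristic function \<open>cf\<close>.\<close>

lemma trig_sum_mult_sums:
  assumes [measurable]: "X \<in> borel_measurable M" "Y \<in> borel_measurable M"
    and cf: "\<And>s t. (\<integral>x. cis (s * X x - t * Y x) \<partial>M) = of_real (exp (- (s\<^sup>2 - 2 * r * s * t + t\<^sup>2) / 2))"
  shows "(\<lambda>k. of_real (r ^ k) * trig_coeff xs k * cnj (trig_coeff ys k))
           sums (\<integral>x. trig_sum xs (X x) * cnj (trig_sum ys (Y x)) \<partial>M)"
proof -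
  have int1: "integrable M (\<lambda>x. c * cis (s * X x) * cnj (trig_sum ys (Y x)))" for c s ys
    using integrable_trig_sum_mult[OF assms(1,2), of "[(c, s)]" ys] by simp
  have int2: "integrable M (\<lambda>x. c * cis (s * X x) * cnj (d * cis (t * Y x)))" for c s d t
    using int1[of c s "[(d, t)]"] by simp
  have single: "(\<lambda>k. of_real (r ^ k) * (c * of_real (exp (- s\<^sup>2 / 2) * s ^ k / sqrt (fact k))) * cnj (trig_coeff ys k))
           sums (\<integral>x. (c * cis (s * X x)) * cnj (trig_sum ys (Y x)) \<partial>M)" for c s
  proof (induction ys)
    case Nil
    show ?case by simp
  next
    case (Cons p ys)
    obtain d t where p: "p = (d, t)" by fastforce
    let ?E = "exp (- (s\<^sup>2 - 2 * r * s * t + t\<^sup>2) / 2)"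
    have "(\<integral>x. (c * cis (s * X x)) * cnj (trig_sum (p # ys) (Y x)) \<partial>M)
        = (\<integral>x. (c * cis (s * X x)) * cnj (d * cis (t * Y x)) + (c * cis (s * X x)) * cnj (trig_sum ys (Y x)) \<partial>M)"
      by (simp add: p distrib_left)
    also have "\<dots> = (\<integral>x. (c * cis (s * X x)) * cnj (d * cis (t * Y x)) \<partial>M) + (\<integral>x. (c * cis (s * X x)) * cnj (trig_sum ys (Y x)) \<partial>M)"
      by (rule Bochner_Integration.integral_add[OF int2 int1])
    also have "(\<integral>x. (c * cis (s * X x)) * cnj (d * cis (t * Y x)) \<partial>M) = (\<integral>x. (c * cnj d) * cis (s * X x - t * Y x) \<partial>M)"
      by (rule Bochner_Integration.integral_cong) (simp_all add: cis_mult cis_cnj flip: cis_mult[of "s * X _" "- (t * Y _)", simplified])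
    also have "\<dots> = (c * cnj d) * of_real ?E" by (simp only: integral_mult_right_zero cf)
    finally have eq: "(\<integral>x. (c * cis (s * X x)) * cnj (trig_sum (p # ys) (Y x)) \<partial>M)
        = (c * cnj d) * of_real ?E + (\<integral>x. (c * cis (s * X x)) * cnj (trig_sum ys (Y x)) \<partial>M)" .
    show ?case unfolding eq
      using sums_add[OF sums_mult[OF gauss_kernel_sums[of r s t], of "c * cnj d"] Cons]
      by (simp add: p algebra_simps)
  qed
  show ?thesis
  proof (induction xs)
    case Nil
    show ?case by simp
  next
    case (Cons p xs)
    obtain c s where p: "p = (c, s)" by fastforce
    have eq: "(\<integral>x. trig_sum (p # xs) (X x) * cnj (trig_sum ys (Y x)) \<partial>M)
        = (\<integral>x. c * cis (s * X x) * cnj (trig_sum ys (Y x)) \<partial>M) + (\<integral>x. trig_sum xs (X x) * cnj (trig_sum ys (Y x)) \<partial>M)"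
      by (simp add: p distrib_right int1 integrable_trig_sum_mult)
    show ?case unfolding eq using sums_add[OF single[of c s] Cons]
      by (simp add: p algebra_simps)
  qed
qed

end

section \<open>Hadamard powers of the correlation matrix and the variance bound for trigonometric
  polynomials\<close>

text \<open>\<open>X_char\<close> expresses that each pair is centred Gaussian with unit variances
  and covariance \<open>\<rho> i j\<close>. Nothing is said about the joint law of three or more
  members.\<close>

locale gaussian_family = prob_space M for M :: "'a measure" +
  fixes X :: "'i::finite \<Rightarrow> 'a \<Rightarrow> real" and \<rho> :: "'i \<Rightarrow> 'i \<Rightarrow> real"
  assumes X_measurable [measurable]: "\<And>i. X i \<in> borel_measurable M"
    and X_square_integrable: "\<And>i. integrable M (\<lambda>x. (X i x)\<^sup>2)"
    and X_variance: "\<And>i. (\<integral>x. (X i x)\<^sup>2 \<partial>M) = 1"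
    and X_covariance: "\<And>i j. (\<integral>x. X i x * X j x \<partial>M) = \<rho> i j"
    and X_char: "\<And>i j s t. (\<integral>x. cis (s * X i x - t * X j x) \<partial>M)
                   = of_real (exp (- (s\<^sup>2 - 2 * \<rho> i j * s * t + t\<^sup>2) / 2))"
begin

lemma \<rho>_diag [simp]: "\<rho> i i = 1"
  using X_covariance[of i i] X_variance[of i] by (simp add: power2_eq_square)

lemma integrable_X_mult: "integrable M (\<lambda>x. X i x * X j x)"
  by (intro integrable_mult_square_integrable X_square_integrable) auto

text \<open>Schur's product theorem for \<open>\<rho>\<close>: since \<open>\<rho> = E[X X\<^sup>T]\<close> is an average of rank one
  matrices, \<open>\<rho> \<circ> B\<close> is an average of matrices congruent to \<open>B\<close>.\<close>

lemma schur_product: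
  assumes B: "\<And>v. 0 \<le> (\<Sum>i\<in>UNIV. \<Sum>j\<in>UNIV. B i j * v i * v j)"
  shows "0 \<le> (\<Sum>i\<in>UNIV. \<Sum>j\<in>UNIV. \<rho> i j * B i j * v i * v j)"
proof -
  have "(\<Sum>i\<in>UNIV. \<Sum>j\<in>UNIV. \<rho> i j * B i j * v i * v j)
      = (\<integral>x. (\<Sum>i\<in>UNIV. \<Sum>j\<in>UNIV. (B i j * v i * v j) * (X i x * X j x)) \<partial>M)"
    by (simp add: integrable_sum integrable_X_mult X_covariance mult_ac)
  also have "\<dots> = (\<integral>x. (\<Sum>i\<in>UNIV. \<Sum>j\<in>UNIV. B i j * (v i * X i x) * (v j * X j x)) \<partial>M)"
    by (simp add: algebra_simps)
  also have "\<dots> \<ge> 0" by (intro Bochner_Integration.integral_nonneg B)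
  finally show ?thesis .
qed

text \<open>The exponent starts at 1: the zeroth Hadamard power is the all-ones matrix, which is
  singular in dimension at least 2 and admits no positive \<open>lam\<close>.\<close>

lemma hadamard_power_bound:
  assumes lam: "\<And>v. lam * (\<Sum>i\<in>UNIV. (v i)\<^sup>2) \<le> (\<Sum>i\<in>UNIV. \<Sum>j\<in>UNIV. \<rho> i j * v i * v j)"
  shows "lam * (\<Sum>i\<in>UNIV. (v i)\<^sup>2) \<le> (\<Sum>i\<in>UNIV. \<Sum>j\<in>UNIV. \<rho> i j ^ Suc k * v i * v j)"
proof -
  define I where "I i j = (if i = j then lam else 0)" for i j :: 'i
  have I: "(\<Sum>i\<in>UNIV. \<Sum>j\<in>UNIV. I i j * v i * v j) = lam * (\<Sum>i\<in>UNIV. (v i)\<^sup>2)" for v :: "'i \<Rightarrow> real"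
    by (simp add: I_def if_distrib[of "\<lambda>z. z * _"] sum_distrib_left power2_eq_square mult.assoc cong: if_cong)
  have "0 \<le> (\<Sum>i\<in>UNIV. \<Sum>j\<in>UNIV. (\<rho> i j ^ Suc k - I i j) * v i * v j)" for v
  proof (induction k arbitrary: v)
    case 0
    then show ?case using lam[of v] by (simp add: left_diff_distrib sum_subtractf I)
  next
    case (Suc k)
    \<comment> \<open>Hadamard multiplication by \<open>\<rho>\<close> fixes \<open>lam\<close>
      times the identity, because the diagonal of \<open>\<rho>\<close> is 1.\<close>
    have "\<rho> i j * (\<rho> i j ^ Suc k - I i j) = \<rho> i j ^ Suc (Suc k) - I i j" for i j
      by (auto simp: I_def algebra_simps)
    then show ?case using schur_product[of "\<lambda>i j. \<rho> i j ^ Suc k - I i j" v] Suc by simp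
  qed
  then show ?thesis by (simp add: left_diff_distrib sum_subtractf I del: power_Suc)
qed

text \<open>In the expansion over \<open>k\<close> the term of order 0 is the contribution of the
  means and is kept exactly; the terms of higher order make up the variances and obey
  \<open>hadamard_power_bound\<close>.\<close>

lemma trig_poly_lower_bound:
  assumes lam: "\<And>v. lam * (\<Sum>i\<in>UNIV. (v i)\<^sup>2) \<le> (\<Sum>i\<in>UNIV. \<Sum>j\<in>UNIV. \<rho> i j * v i * v j)"
    and h: "\<And>i. trig_poly (h i)"
  shows "expectation (\<lambda>x. \<Sum>i\<in>UNIV. h i (X i x))^2
          + lam * (\<Sum>i\<in>UNIV. expectation (\<lambda>x. (h i (X i x))\<^sup>2) - (expectation (\<lambda>x. h i (X i x)))\<^sup>2)
         \<le> expectation (\<lambda>x. (\<Sum>i\<in>UNIV. h i (X i x))\<^sup>2)"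
proof -
  obtain xs where xs: "\<And>i x. complex_of_real (h i x) = trig_sum (xs i) x"
    using h unfolding trig_poly_def by metis
  define a where "a i k = trig_coeff (xs i) k" for i k
  have prod: "complex_of_real (h i x * h j y) = trig_sum (xs i) x * cnj (trig_sum (xs j) y)" for i j x y
    by (metis xs complex_cnj_complex_of_real of_real_mult)
  have int_hh: "integrable M (\<lambda>x. h i (X i x) * h j (X j x))" for i j
  proof -
    have "integrable M (\<lambda>x. Re (trig_sum (xs i) (X i x) * cnj (trig_sum (xs j) (X j x))))"
      by (intro integrable_Re integrable_trig_sum_mult) auto
    then show ?thesis by (simp only: prod[symmetric] Re_complex_of_real)
  qed
  have int_h: "integrable M (\<lambda>x. h i (X i x))" for i
  proof -
    have "integrable M (\<lambda>x. Re (trig_sum (xs i) (X i x) * cnj (trig_sum [(1, 0)] (X i x))))"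
      by (intro integrable_Re integrable_trig_sum_mult) auto
    then show ?thesis by (simp add: xs[symmetric])
  qed
  define m where "m i = expectation (\<lambda>x. h i (X i x))" for i
  define c where "c i j = expectation (\<lambda>x. h i (X i x) * h j (X j x))" for i j
  have c: "(\<lambda>k. \<rho> i j ^ k * (Re (a i k) * Re (a j k) + Im (a i k) * Im (a j k))) sums c i j" for i j
  proof -
    have "(\<lambda>k. of_real (\<rho> i j ^ k) * a i k * cnj (a j k)) sums
          (\<integral>x. trig_sum (xs i) (X i x) * cnj (trig_sum (xs j) (X j x)) \<partial>M)"
      unfolding a_def by (rule trig_sum_mult_sums) (use X_char in auto)
    also have "(\<integral>x. trig_sum (xs i) (X i x) * cnj (trig_sum (xs j) (X j x)) \<partial>M) = of_real (c i j)"
      by (simp only: prod[symmetric] c_def integral_complex_of_real)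
    finally have "(\<lambda>k. Re (of_real (\<rho> i j ^ k) * a i k * cnj (a j k))) sums Re (of_real (c i j))"
      by (rule sums_Re)
    then show ?thesis by (simp add: algebra_simps)
  qed
  \<comment> \<open>The list \<open>[(1, 0)]\<close> is the constant 1. Its coefficients of positive
    order vanish, so pairing with it isolates the coefficient of order 0, the mean.\<close>
  have m: "a i 0 = of_real (m i)" for i
  proof -
    have "(\<lambda>k. of_real (\<rho> i i ^ k) * a i k * cnj (trig_coeff [(1, 0)] k)) sums
          (\<integral>x. trig_sum (xs i) (X i x) * cnj (trig_sum [(1, 0)] (X i x)) \<partial>M)"
      unfolding a_def by (rule trig_sum_mult_sums) (use X_char in auto)
    also have "(\<lambda>k. of_real (\<rho> i i ^ k) * a i k * cnj (trig_coeff [(1, 0)] k)) = (\<lambda>k. if k = 0 then a i 0 else 0)"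
      by (auto simp: power_0_left)
    also have "(\<integral>x. trig_sum (xs i) (X i x) * cnj (trig_sum [(1, 0)] (X i x)) \<partial>M) = of_real (m i)"
      by (simp add: xs[symmetric] m_def)
    finally show ?thesis using sums_unique2 sums_single[of 0 "\<lambda>k. a i 0"] by fastforce
  qed
  \<comment> \<open>The order \<open>k\<close> part of the second moment of the sum minus
    \<open>lam\<close> times the sum of the second moments.\<close>
  let ?T = "\<lambda>k. (\<Sum>i\<in>UNIV. \<Sum>j\<in>UNIV. \<rho> i j ^ k * (Re (a i k) * Re (a j k) + Im (a i k) * Im (a j k)))
                 - lam * (\<Sum>i\<in>UNIV. (Re (a i k))\<^sup>2 + (Im (a i k))\<^sup>2)"
  have sq: "expectation (\<lambda>x. (\<Sum>i\<in>UNIV. h i (X i x))\<^sup>2) = (\<Sum>i\<in>UNIV. \<Sum>j\<in>UNIV. c i j)"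
    unfolding power2_eq_square sum_product c_def by (simp add: int_hh integrable_sum)
  have T: "?T sums (expectation (\<lambda>x. (\<Sum>i\<in>UNIV. h i (X i x))\<^sup>2) - lam * (\<Sum>i\<in>UNIV. c i i))"
    unfolding sq
  proof (intro sums_diff sums_sum sums_mult c)
    show "(\<lambda>k. (Re (a i k))\<^sup>2 + (Im (a i k))\<^sup>2) sums c i i" for i
      using c[of i i] by (simp add: power2_eq_square)
  qed
  \<comment> \<open>The Hadamard bound concerns real vectors and is applied to the real and
    imaginary parts of the coefficients separately; taking real parts of the series has removed the
    cross terms.\<close>
  have "?T k \<ge> 0" if "k \<ge> 1" for k
  proof -
    obtain n where n: "k = Suc n" using \<open>k \<ge> 1\<close> by (metis Suc_le_D One_nat_def)
    have "lam * (\<Sum>i\<in>UNIV. (Re (a i k))\<^sup>2) \<le> (\<Sum>i\<in>UNIV. \<Sum>j\<in>UNIV. \<rho> i j ^ k * Re (a i k) * Re (a j k))"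
      unfolding n by (rule hadamard_power_bound[OF lam])
    moreover have "lam * (\<Sum>i\<in>UNIV. (Im (a i k))\<^sup>2) \<le> (\<Sum>i\<in>UNIV. \<Sum>j\<in>UNIV. \<rho> i j ^ k * Im (a i k) * Im (a j k))"
      unfolding n by (rule hadamard_power_bound[OF lam])
    ultimately show ?thesis
      by (simp only: distrib_left sum.distrib mult.assoc)
  qed
  \<comment> \<open>All orders but 0 contribute nonnegatively and are dropped.\<close>
  then have "sum ?T {0} \<le> suminf ?T"
    by (intro sum_le_suminf sums_summable[OF T]) auto
  then have "?T 0 \<le> expectation (\<lambda>x. (\<Sum>i\<in>UNIV. h i (X i x))\<^sup>2) - lam * (\<Sum>i\<in>UNIV. c i i)"
    using sums_unique[OF T] by simp
  moreover have "?T 0 = (\<Sum>i\<in>UNIV. m i)\<^sup>2 - lam * (\<Sum>i\<in>UNIV. (m i)\<^sup>2)"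
    by (simp add: m sum_product power2_eq_square)
  moreover have "expectation (\<lambda>x. \<Sum>i\<in>UNIV. h i (X i x)) = (\<Sum>i\<in>UNIV. m i)"
    by (simp add: m_def int_h)
  ultimately show ?thesis
    by (simp add: c_def m_def sum_subtractf right_diff_distrib power2_eq_square[of "h _ _"])
qed

end

subsection \<open>Convergence in \<open>L\<^sup>2\<close> and characteristic functions of Gaussians\<close>

text \<open>The quadratic has its minimum at \<open>t = 0\<close>, so its derivative there vanishes.
  This is the first-order condition for the Rayleigh quotient.\<close>

lemma linear_part_zero_of_nonneg_quadratic:
  fixes a b :: real
  assumes "\<And>t. 0 \<le> 2 * t * a + t\<^sup>2 * b"
  shows "a = 0"
proof (rule ccontr)
  assume a: "a \<noteq> 0"
  \<comment> \<open>A positive upper bound for \<open>b\<close>, which may itself be zero or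
    negative.\<close>
  define c where "c = \<bar>b\<bar> + 1"
  have c: "c > 0" "b \<le> c" by (auto simp: c_def)
  have "0 \<le> 2 * (- a / c) * a + (- a / c)\<^sup>2 * b" by (rule assms)
  also have "\<dots> \<le> 2 * (- a / c) * a + (- a / c)\<^sup>2 * c" using c by (intro add_left_mono mult_left_mono) auto
  also have "\<dots> = - (a\<^sup>2 / c)" using c by (simp add: field_simps power2_eq_square)
  also have "\<dots> < 0" using a c by simp
  finally show False by simp
qed

text \<open>Evaluate at the minimum \<open>- b / c\<close>. If \<open>c = 0\<close>, the function is
  affine and nonnegative, hence constant.\<close>

lemma nonneg_quadratic_discriminant:
  fixes a b c :: real
  assumes "0 \<le> c" and q: "\<And>t. 0 \<le> a + 2 * t * b + t\<^sup>2 * c"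
  shows "b\<^sup>2 \<le> a * c"
proof (cases "c = 0")
  case True
  have "b = 0"
  proof (rule ccontr)
    assume "b \<noteq> 0"
    then have "a + 2 * (- (a + 1) / (2 * b)) * b = - 1" by (simp add: field_simps)
    then show False using q[of "- (a + 1) / (2 * b)"] True by simp
  qed
  then show ?thesis using True by simp
next
  case False
  then have c: "c > 0" using assms(1) by simp
  have "a + 2 * (- b / c) * b + (- b / c)\<^sup>2 * c = (a * c - b\<^sup>2) / c"
    using c by (simp add: field_simps power2_eq_square)
  then have "0 \<le> (a * c - b\<^sup>2) / c" using q[of "- b / c"] by simp
  then show ?thesis using c by (simp add: zero_le_divide_iff)
qed

lemma sum_power2_le:
  fixes v :: "'i::finite \<Rightarrow> real"
  shows "(\<Sum>i\<in>UNIV. v i)\<^sup>2 \<le> real CARD('i) * (\<Sum>i\<in>UNIV. (v i)\<^sup>2)"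
  using Cauchy_Schwarz_ineq_sum[of "\<lambda>_. 1" v UNIV] by simp

context prob_space begin

lemma expectation_Cauchy_Schwarz:
  fixes f g :: "'a \<Rightarrow> real"
  assumes [measurable]: "f \<in> borel_measurable M" "g \<in> borel_measurable M"
    and i: "integrable M (\<lambda>x. (f x)\<^sup>2)" "integrable M (\<lambda>x. (g x)\<^sup>2)"
  shows "(expectation (\<lambda>x. f x * g x))\<^sup>2 \<le> expectation (\<lambda>x. (f x)\<^sup>2) * expectation (\<lambda>x. (g x)\<^sup>2)"
proof (rule nonneg_quadratic_discriminant)
  show "0 \<le> expectation (\<lambda>x. (g x)\<^sup>2)" by simp
  fix t
  have "0 \<le> expectation (\<lambda>x. (f x + t * g x)\<^sup>2)" by simp
  also have "(\<lambda>x. (f x + t * g x)\<^sup>2) = (\<lambda>x. (f x)\<^sup>2 + 2 * t * (f x * g x) + t\<^sup>2 * (g x)\<^sup>2)"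
    by (auto simp: power2_eq_square algebra_simps)
  also have "expectation \<dots> = expectation (\<lambda>x. (f x)\<^sup>2) + 2 * t * expectation (\<lambda>x. f x * g x)
      + t\<^sup>2 * expectation (\<lambda>x. (g x)\<^sup>2)"
    using integrable_mult_square_integrable[OF assms] i by simp
  finally show "0 \<le> \<dots>" .
qed

text \<open>By Cauchy-Schwarz the expectation of \<open>g x * (f x - F n x)\<close> tends to 0 for
  every square-integrable \<open>g\<close>; the two claims use \<open>g = 1\<close> and
  \<open>g = f\<close>.\<close>

lemma tendsto_expectation_L2:
  fixes f :: "'a \<Rightarrow> real" and F :: "nat \<Rightarrow> 'a \<Rightarrow> real"
  assumes [measurable]: "f \<in> borel_measurable M" "\<And>n. F n \<in> borel_measurable M"
    and i: "integrable M (\<lambda>x. (f x)\<^sup>2)" "\<And>n. integrable M (\<lambda>x. (F n x)\<^sup>2)"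
    and lim: "(\<lambda>n. expectation (\<lambda>x. (f x - F n x)\<^sup>2)) \<longlonglongrightarrow> 0"
  shows "(\<lambda>n. expectation (F n)) \<longlonglongrightarrow> expectation f"
    and "(\<lambda>n. expectation (\<lambda>x. (F n x)\<^sup>2)) \<longlonglongrightarrow> expectation (\<lambda>x. (f x)\<^sup>2)"
proof -
  define D where "D n = expectation (\<lambda>x. (f x - F n x)\<^sup>2)" for n
  have iD: "integrable M (\<lambda>x. (f x - F n x)\<^sup>2)" for n using i by (intro integrable_power2_diff) auto
  have cs: "(\<lambda>n. expectation (\<lambda>x. g x * (f x - F n x))) \<longlonglongrightarrow> 0"
    if [measurable]: "g \<in> borel_measurable M" and g: "integrable M (\<lambda>x. (g x)\<^sup>2)" for g
  proof -
    have "(\<lambda>n. (expectation (\<lambda>x. g x * (f x - F n x)))\<^sup>2) \<longlonglongrightarrow> 0"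
    proof (rule tendsto_sandwich[OF _ _ tendsto_const])
      show "(\<lambda>n. expectation (\<lambda>x. (g x)\<^sup>2) * D n) \<longlonglongrightarrow> 0"
        using tendsto_mult_right_zero[OF lim] unfolding D_def .
      show "eventually (\<lambda>n. (expectation (\<lambda>x. g x * (f x - F n x)))\<^sup>2 \<le> expectation (\<lambda>x. (g x)\<^sup>2) * D n) sequentially"
        unfolding D_def by (intro always_eventually allI expectation_Cauchy_Schwarz g iD) auto
    qed auto
    then show ?thesis by simp
  qed
  have intf: "integrable M f" by (rule square_integrable_imp_integrable) (use i in auto)
  have intF: "integrable M (F n)" for n by (rule square_integrable_imp_integrable) (use i in auto)
  have "(\<lambda>n. expectation f - expectation (\<lambda>x. 1 * (f x - F n x))) \<longlonglongrightarrow> expectation f - 0"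
    by (intro tendsto_diff tendsto_const cs) auto
  then show "(\<lambda>n. expectation (F n)) \<longlonglongrightarrow> expectation f" by (simp add: intf intF)
  have ifD: "integrable M (\<lambda>x. f x * (f x - F n x))" for n
    by (intro integrable_mult_square_integrable i iD) auto
  have "expectation (\<lambda>x. (F n x)\<^sup>2) = expectation (\<lambda>x. (f x)\<^sup>2) - 2 * expectation (\<lambda>x. f x * (f x - F n x)) + D n" for n
  proof -
    have "(\<lambda>x. (F n x)\<^sup>2) = (\<lambda>x. (f x)\<^sup>2 - 2 * (f x * (f x - F n x)) + (f x - F n x)\<^sup>2)"
      by (auto simp: power2_eq_square algebra_simps)
    then show ?thesis unfolding D_def using i ifD iD by simp
  qed
  moreover have "(\<lambda>n. expectation (\<lambda>x. (f x)\<^sup>2) - 2 * expectation (\<lambda>x. f x * (f x - F n x)) + D n)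
      \<longlonglongrightarrow> expectation (\<lambda>x. (f x)\<^sup>2) - 2 * 0 + 0"
    using lim unfolding D_def[symmetric] by (intro tendsto_intros cs i) auto
  ultimately show "(\<lambda>n. expectation (\<lambda>x. (F n x)\<^sup>2)) \<longlonglongrightarrow> expectation (\<lambda>x. (f x)\<^sup>2)" by simp
qed

text \<open>Cauchy-Schwarz at each point; the cardinality here becomes the dimension in the final
  bound.\<close>

lemma integrable_sum_power2:
  fixes f :: "'i::finite \<Rightarrow> 'a \<Rightarrow> real"
  assumes [measurable]: "\<And>i. f i \<in> borel_measurable M" and i: "\<And>i. integrable M (\<lambda>x. (f i x)\<^sup>2)"
  shows "integrable M (\<lambda>x. (\<Sum>i\<in>UNIV. f i x)\<^sup>2)"
    and "expectation (\<lambda>x. (\<Sum>i\<in>UNIV. f i x)\<^sup>2) \<le> real CARD('i) * (\<Sum>i\<in>UNIV. expectation (\<lambda>x. (f i x)\<^sup>2))"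
proof -
  have b: "integrable M (\<lambda>x. real CARD('i) * (\<Sum>i\<in>UNIV. (f i x)\<^sup>2))" using i by auto
  show s: "integrable M (\<lambda>x. (\<Sum>i\<in>UNIV. f i x)\<^sup>2)"
    by (rule Bochner_Integration.integrable_bound[OF b])
       (auto intro!: always_eventually order_trans[OF sum_power2_le abs_ge_self])
  have "expectation (\<lambda>x. (\<Sum>i\<in>UNIV. f i x)\<^sup>2) \<le> expectation (\<lambda>x. real CARD('i) * (\<Sum>i\<in>UNIV. (f i x)\<^sup>2))"
    by (intro integral_mono s b sum_power2_le)
  also have "\<dots> = real CARD('i) * (\<Sum>i\<in>UNIV. expectation (\<lambda>x. (f i x)\<^sup>2))" using i by simp
  finally show "expectation (\<lambda>x. (\<Sum>i\<in>UNIV. f i x)\<^sup>2) \<le> real CARD('i) * (\<Sum>i\<in>UNIV. expectation (\<lambda>x. (f i x)\<^sup>2))" .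
qed

section \<open>Second moments and characteristic functions of Gaussian variables\<close>

lemma gaussian_rv_square_integrable:
  assumes [measurable]: "Z \<in> borel_measurable M" and "gaussian_rv M Z"
  shows "integrable M (\<lambda>x. (Z x)\<^sup>2)"
  using assms(2) unfolding gaussian_rv_def
proof (elim disjE exE conjE)
  fix mu sigma :: real
  assume s: "sigma > 0" and d: "distr M borel Z = density lborel (normal_density mu sigma)"
  have dist: "distributed M lborel Z (normal_density mu sigma)"
    using d s unfolding distributed_def by (auto cong: distr_cong)
  have k: "integrable M (\<lambda>x. (Z x - mu) ^ k)" for k
    using distributed_integrable[OF dist, of "\<lambda>x. (x - mu) ^ k"] integrable_normal_moment[OF s, of mu k] by simp
  have "integrable M (\<lambda>x. (Z x - mu)\<^sup>2 + 2 * mu * (Z x - mu) ^ 1 + mu\<^sup>2)"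
    by (intro Bochner_Integration.integrable_add integrable_mult_right k) simp
  also have "(\<lambda>x. (Z x - mu)\<^sup>2 + 2 * mu * (Z x - mu) ^ 1 + mu\<^sup>2) = (\<lambda>x. (Z x)\<^sup>2)"
    by (auto simp: power2_eq_square algebra_simps)
  finally show ?thesis .
next
  fix c assume d: "distr M borel Z = return borel c"
  have "integrable (distr M borel Z) (\<lambda>x. x\<^sup>2)"
    unfolding d by (rule integrableI_bounded) (simp_all add: nn_integral_return)
  then show ?thesis by (subst (asm) integrable_distr_eq) auto
qed

text \<open>Standardizing reduces the claim to the standard normal law. Point masses must be covered
  too, since a linear combination of two coordinates can be constant; their variance is 0 and the
  exponential factor is 1.\<close>

lemma gaussian_rv_char:
  assumes [measurable]: "Z \<in> borel_measurable M" and g: "gaussian_rv M Z"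
  shows "(\<integral>x. cis (Z x + c) \<partial>M) = cis (expectation Z + c) * of_real (exp (- variance Z / 2))"
  using g unfolding gaussian_rv_def
proof (elim disjE exE conjE)
  fix mu sigma :: real
  assume s: "sigma > 0" and d: "distr M borel Z = density lborel (normal_density mu sigma)"
  have dist: "distributed M lborel Z (normal_density mu sigma)"
    using d s unfolding distributed_def by (auto cong: distr_cong)
  have E: "expectation Z = mu" by (rule normal_distributed_expectation[OF s dist])
  have V: "variance Z = sigma\<^sup>2" by (rule normal_distributed_variance[OF s dist])
  define W where "W x = (Z x - mu) / sigma" for x
  have [measurable]: "W \<in> borel_measurable M" unfolding W_def by measurable
  have "distributed M lborel W std_normal_density"
    unfolding W_def using normal_standard_normal_convert[OF s, of Z mu] dist by simp
  then have dW: "distr M lborel W = std_normal_distribution" by (rule distributed_distr_eq_density)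
  have "(\<integral>x. cis (sigma * W x) \<partial>M) = (\<integral>y. cis (sigma * y) \<partial>distr M lborel W)"
    by (subst integral_distr) (auto intro!: borel_measurable_continuous_onI continuous_intros)
  also have "\<dots> = char std_normal_distribution sigma"
    unfolding dW char_def by (simp add: cis_conv_exp)
  also have "\<dots> = of_real (exp (- sigma\<^sup>2 / 2))" by (simp add: char_std_normal_distribution)
  finally have W: "(\<integral>x. cis (sigma * W x) \<partial>M) = of_real (exp (- sigma\<^sup>2 / 2))" .
  have "(\<integral>x. cis (Z x + c) \<partial>M) = (\<integral>x. cis (mu + c) * cis (sigma * W x) \<partial>M)"
    using s by (intro Bochner_Integration.integral_cong) (simp_all add: cis_mult W_def add_ac)
  also have "\<dots> = cis (mu + c) * of_real (exp (- sigma\<^sup>2 / 2))"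
    unfolding integral_mult_right_zero W ..
  finally show ?thesis unfolding V unfolding E .
next
  fix a assume d: "distr M borel Z = return borel a"
  have I: "(\<integral>x. f (Z x) \<partial>M) = f a" if "f \<in> borel_measurable borel"
    for f :: "real \<Rightarrow> 'c::{banach, second_countable_topology}"
  proof -
    have "(\<integral>x. f (Z x) \<partial>M) = (\<integral>y. f y \<partial>distr M borel Z)"
      by (subst integral_distr) (use that in auto)
    also have "\<dots> = f a" unfolding d using that by (subst integral_return) auto
    finally show ?thesis .
  qed
  have E: "expectation Z = a" using I[of "\<lambda>x. x"] by simp
  have V: "variance Z = 0" unfolding E using I[of "\<lambda>x. (x - a)\<^sup>2"] by simp
  have "(\<lambda>x. cis (x + c)) \<in> borel_measurable borel"
    by (intro borel_measurable_continuous_onI continuous_intros)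
  then show ?thesis unfolding V unfolding E using I[of "\<lambda>x. cis (x + c)"] by simp
qed

end

subsection \<open>The smallest eigenvalue of a symmetric matrix\<close>

context
  fixes A :: "real^'n^'n"
  assumes sym: "transpose A = A"
begin

lemma symmetric_inner: "x \<bullet> (A *v y) = (A *v x) \<bullet> y"
  by (metis sym dot_lmul_matrix vector_transpose_matrix)

text \<open>Eigenvectors of distinct eigenvalues are orthogonal, hence independent. Finiteness is
  what gives the \<open>Min\<close> in \<open>lambda_min\<close> its meaning.\<close>

lemma finite_eigenvalues: "finite {l. \<exists>v. v \<noteq> 0 \<and> A *v v = l *\<^sub>R v}"
proof -
  let ?E = "{l. \<exists>v. v \<noteq> 0 \<and> A *v v = l *\<^sub>R v}"
  obtain v where v: "\<And>l. l \<in> ?E \<Longrightarrow> v l \<noteq> 0 \<and> A *v v l = l *\<^sub>R v l"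
    using bchoice[of ?E "\<lambda>l v. v \<noteq> 0 \<and> A *v v = l *\<^sub>R v"] by auto
  have orth: "v k \<bullet> v l = 0" if "k \<in> ?E" "l \<in> ?E" "k \<noteq> l" for k l
  proof -
    have "l * (v k \<bullet> v l) = k * (v k \<bullet> v l)"
      using symmetric_inner[of "v k" "v l"] v[OF that(1)] v[OF that(2)] by simp
    then show ?thesis using that(3) by simp
  qed
  have inj: "inj_on v ?E"
  proof (rule inj_onI, rule ccontr)
    fix k l assume *: "k \<in> ?E" "l \<in> ?E" "v k = v l" "k \<noteq> l"
    then have "v k \<bullet> v k = 0" using orth[of k l] by simp
    then show False using v[OF *(1)] by simp
  qed
  have "pairwise orthogonal (v ` ?E)" unfolding pairwise_def orthogonal_def using orth by force
  moreover have "0 \<notin> v ` ?E" using v by force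
  ultimately have "independent (v ` ?E)" by (rule pairwise_orthogonal_independent)
  then have "finite (v ` ?E)" by (rule independent_imp_finite)
  then show ?thesis using inj finite_image_iff by blast
qed

text \<open>A minimizer of the quadratic form on the compact unit sphere is an eigenvector.\<close>

lemma rayleigh_minimum: "\<exists>l u. u \<noteq> 0 \<and> A *v u = l *\<^sub>R u \<and> (\<forall>v. l * (v \<bullet> v) \<le> v \<bullet> (A *v v))"
proof -
  have "continuous_on (sphere 0 1) (\<lambda>v::real^'n. v \<bullet> (A *v v))"
    by (intro continuous_intros matrix_vector_mult_linear_continuous_on)
  moreover have "sphere 0 1 \<noteq> ({} :: (real^'n) set)" by simp
  ultimately obtain u where u: "u \<in> sphere 0 1"
    and min: "\<And>v. v \<in> sphere 0 1 \<Longrightarrow> u \<bullet> (A *v u) \<le> v \<bullet> (A *v v)"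
    using continuous_attains_inf[of "sphere 0 1" "\<lambda>v::real^'n. v \<bullet> (A *v v)"] by auto
  define l where "l = u \<bullet> (A *v u)"
  have uu: "u \<bullet> u = 1" using u by (simp add: dot_square_norm)
  have ray: "l * (v \<bullet> v) \<le> v \<bullet> (A *v v)" for v
  proof (cases "v = 0")
    case False
    have "l \<le> ((1 / norm v) *\<^sub>R v) \<bullet> (A *v ((1 / norm v) *\<^sub>R v))"
      unfolding l_def using False by (intro min) simp
    also have "\<dots> = (v \<bullet> (A *v v)) / (v \<bullet> v)"
      by (simp add: matrix_vector_mult_scaleR dot_square_norm power2_eq_square)
    finally show ?thesis using False by (simp add: field_simps)
  qed simp
  \<comment> \<open>Moving the minimizer \<open>u\<close> in the direction of its residual
    \<open>w\<close> changes the form to first order by \<open>2 * t * (w \<bullet> w)\<close>, so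
    the residual must vanish.\<close>
  define w where "w = A *v u - l *\<^sub>R u"
  have "w \<bullet> w = 0"
  proof (rule linear_part_zero_of_nonneg_quadratic)
    fix t
    have "0 \<le> (u + t *\<^sub>R w) \<bullet> (A *v (u + t *\<^sub>R w)) - l * ((u + t *\<^sub>R w) \<bullet> (u + t *\<^sub>R w))"
      using ray[of "u + t *\<^sub>R w"] by simp
    also have "\<dots> = (u \<bullet> (A *v u) - l * (u \<bullet> u)) + 2 * t * (w \<bullet> (A *v u) - l * (w \<bullet> u)) + t\<^sup>2 * (w \<bullet> (A *v w) - l * (w \<bullet> w))"
      by (simp add: matrix_vector_right_distrib matrix_vector_mult_scaleR inner_add_left inner_add_right
           symmetric_inner[of u w] inner_commute[of "A *v u" w] inner_commute[of u w] power2_eq_square algebra_simps)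
    also have "u \<bullet> (A *v u) - l * (u \<bullet> u) = 0" by (simp add: uu l_def)
    also have "w \<bullet> (A *v u) - l * (w \<bullet> u) = w \<bullet> w" by (simp add: w_def inner_diff_right inner_diff_left)
    finally show "0 \<le> 2 * t * (w \<bullet> w) + t\<^sup>2 * (w \<bullet> (A *v w) - l * (w \<bullet> w))" by simp
  qed
  then have "A *v u = l *\<^sub>R u" by (simp add: w_def)
  moreover have "u \<noteq> 0" using uu by auto
  ultimately show ?thesis using ray by blast
qed

lemma lambda_min_rayleigh: "lambda_min A * (v \<bullet> v) \<le> v \<bullet> (A *v v)"
proof -
  obtain l u where lu: "u \<noteq> 0" "A *v u = l *\<^sub>R u" and ray: "\<And>v. l * (v \<bullet> v) \<le> v \<bullet> (A *v v)"
    using rayleigh_minimum by blast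
  have "lambda_min A \<le> l" unfolding lambda_min_def using lu finite_eigenvalues by (intro Min_le) auto
  then have "lambda_min A * (v \<bullet> v) \<le> l * (v \<bullet> v)" by (intro mult_right_mono) auto
  then show ?thesis using ray[of v] by simp
qed

lemma lambda_min_eigenvalue: "\<exists>v. v \<noteq> 0 \<and> A *v v = lambda_min A *\<^sub>R v"
proof -
  have "lambda_min A \<in> {l. \<exists>v. v \<noteq> 0 \<and> A *v v = l *\<^sub>R v}"
    unfolding lambda_min_def using rayleigh_minimum finite_eigenvalues by (intro Min_in) auto
  then show ?thesis by blast
qed

end

subsection \<open>Additive functions of pairwise Gaussian coordinates\<close>

context gaussian_family begin

text \<open>Each \<open>h i\<close> is approximated in L2 of the law of \<open>X i\<close>; every
  expectation in \<open>trig_poly_lower_bound\<close> then converges.\<close>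

theorem additive_lower_bound:
  assumes lam: "\<And>v. lam * (\<Sum>i\<in>UNIV. (v i)\<^sup>2) \<le> (\<Sum>i\<in>UNIV. \<Sum>j\<in>UNIV. \<rho> i j * v i * v j)"
    and h [measurable]: "\<And>i. h i \<in> borel_measurable borel"
    and int: "\<And>i. integrable M (\<lambda>x. (h i (X i x))\<^sup>2)"
  shows "expectation (\<lambda>x. \<Sum>i\<in>UNIV. h i (X i x))^2
          + lam * (\<Sum>i\<in>UNIV. expectation (\<lambda>x. (h i (X i x))\<^sup>2) - (expectation (\<lambda>x. h i (X i x)))\<^sup>2)
         \<le> expectation (\<lambda>x. (\<Sum>i\<in>UNIV. h i (X i x))\<^sup>2)"
proof -
  have "\<exists>g. trig_poly g \<and> expectation (\<lambda>x. (h i (X i x) - g (X i x))\<^sup>2) < 1 / real (Suc n)" for i n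
  proof -
    interpret D: borel_prob "distr M borel (X i)"
      by (auto simp: borel_prob_def borel_prob_axioms_def intro: prob_space_distr)
    have "integrable (distr M borel (X i)) (\<lambda>x. (h i x)\<^sup>2)"
      using int[of i] by (subst integrable_distr_eq) auto
    then have "trig_approximable (distr M borel (X i)) (h i)" by (intro D.trig_approximable) auto
    then obtain g where g: "trig_poly g" "(\<integral>x. (h i x - g x)\<^sup>2 \<partial>distr M borel (X i)) < 1 / real (Suc n)"
      unfolding trig_approximable_def by (meson of_nat_0_less_iff zero_less_Suc zero_less_divide_1_iff)
    note [measurable] = trig_poly_measurable[OF g(1)]
    have "(\<integral>x. (h i x - g x)\<^sup>2 \<partial>distr M borel (X i)) = expectation (\<lambda>x. (h i (X i x) - g (X i x))\<^sup>2)"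
      by (subst integral_distr) auto
    then show ?thesis using g by auto
  qed
  then obtain g where g: "\<And>i n. trig_poly (g i n)"
    and close: "\<And>i n. expectation (\<lambda>x. (h i (X i x) - g i n (X i x))\<^sup>2) < 1 / real (Suc n)" by metis
  note [measurable] = trig_poly_measurable[OF g]
  have intg: "integrable M (\<lambda>x. (g i n (X i x))\<^sup>2)" for i n
    using trig_poly_bounded[OF g[of i n]] integrable_bounded_power2[of "\<lambda>x. g i n (X i x)"] by auto
  have lim0: "(\<lambda>n. 1 / real (Suc n)) \<longlonglongrightarrow> 0"
    using LIMSEQ_inverse_real_of_nat by (simp add: inverse_eq_divide)
  have lim: "(\<lambda>n. expectation (\<lambda>x. (h i (X i x) - g i n (X i x))\<^sup>2)) \<longlonglongrightarrow> 0" for i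
    by (rule tendsto_sandwich[OF _ _ tendsto_const lim0])
       (use close in \<open>auto intro!: always_eventually less_imp_le simp del: of_nat_Suc\<close>)
  have int_diff: "integrable M (\<lambda>x. (h i (X i x) - g i n (X i x))\<^sup>2)" for i n
    by (intro integrable_power2_diff int intg) auto
  have lim_sum: "(\<lambda>n. expectation (\<lambda>x. ((\<Sum>i\<in>UNIV. h i (X i x)) - (\<Sum>i\<in>UNIV. g i n (X i x)))\<^sup>2)) \<longlonglongrightarrow> 0"
  proof (rule tendsto_sandwich[OF _ _ tendsto_const])
    have "(\<lambda>n. real CARD('i) * (\<Sum>i\<in>UNIV. expectation (\<lambda>x. (h i (X i x) - g i n (X i x))\<^sup>2)))
            \<longlonglongrightarrow> real CARD('i) * (\<Sum>i\<in>(UNIV::'i set). 0)"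
      by (intro tendsto_intros lim)
    then show "(\<lambda>n. real CARD('i) * (\<Sum>i\<in>UNIV. expectation (\<lambda>x. (h i (X i x) - g i n (X i x))\<^sup>2))) \<longlonglongrightarrow> 0"
      by simp
    have "expectation (\<lambda>x. ((\<Sum>i\<in>UNIV. h i (X i x)) - (\<Sum>i\<in>UNIV. g i n (X i x)))\<^sup>2)
        \<le> real CARD('i) * (\<Sum>i\<in>UNIV. expectation (\<lambda>x. (h i (X i x) - g i n (X i x))\<^sup>2))" for n
      using integrable_sum_power2(2)[of "\<lambda>i x. h i (X i x) - g i n (X i x)"] int_diff by (simp add: sum_subtractf)
    then show "eventually (\<lambda>n. expectation (\<lambda>x. ((\<Sum>i\<in>UNIV. h i (X i x)) - (\<Sum>i\<in>UNIV. g i n (X i x)))\<^sup>2)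
        \<le> real CARD('i) * (\<Sum>i\<in>UNIV. expectation (\<lambda>x. (h i (X i x) - g i n (X i x))\<^sup>2))) sequentially"
      by simp
  qed auto
  have int_sum: "integrable M (\<lambda>x. (\<Sum>i\<in>UNIV. h i (X i x))\<^sup>2)" "integrable M (\<lambda>x. (\<Sum>i\<in>UNIV. g i n (X i x))\<^sup>2)" for n
    by (intro integrable_sum_power2 int intg; measurable)+
  have L1: "(\<lambda>n. expectation (\<lambda>x. g i n (X i x))) \<longlonglongrightarrow> expectation (\<lambda>x. h i (X i x))"
       "(\<lambda>n. expectation (\<lambda>x. (g i n (X i x))\<^sup>2)) \<longlonglongrightarrow> expectation (\<lambda>x. (h i (X i x))\<^sup>2)" for i
    by (rule tendsto_expectation_L2[OF _ _ int intg lim]; measurable)+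
  have L2: "(\<lambda>n. expectation (\<lambda>x. \<Sum>i\<in>UNIV. g i n (X i x))) \<longlonglongrightarrow> expectation (\<lambda>x. \<Sum>i\<in>UNIV. h i (X i x))"
       "(\<lambda>n. expectation (\<lambda>x. (\<Sum>i\<in>UNIV. g i n (X i x))\<^sup>2)) \<longlonglongrightarrow> expectation (\<lambda>x. (\<Sum>i\<in>UNIV. h i (X i x))\<^sup>2)"
    by (rule tendsto_expectation_L2[OF _ _ int_sum lim_sum]; measurable)+
  show ?thesis
  proof (rule LIMSEQ_le[OF _ L2(2)])
    show "(\<lambda>n. expectation (\<lambda>x. \<Sum>i\<in>UNIV. g i n (X i x))^2
          + lam * (\<Sum>i\<in>UNIV. expectation (\<lambda>x. (g i n (X i x))\<^sup>2) - (expectation (\<lambda>x. g i n (X i x)))\<^sup>2))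
        \<longlonglongrightarrow> expectation (\<lambda>x. \<Sum>i\<in>UNIV. h i (X i x))^2
          + lam * (\<Sum>i\<in>UNIV. expectation (\<lambda>x. (h i (X i x))\<^sup>2) - (expectation (\<lambda>x. h i (X i x)))\<^sup>2)"
      by (intro tendsto_intros L1 L2)
    show "\<exists>N. \<forall>n\<ge>N. expectation (\<lambda>x. \<Sum>i\<in>UNIV. g i n (X i x))^2
          + lam * (\<Sum>i\<in>UNIV. expectation (\<lambda>x. (g i n (X i x))\<^sup>2) - (expectation (\<lambda>x. g i n (X i x)))\<^sup>2)
         \<le> expectation (\<lambda>x. (\<Sum>i\<in>UNIV. g i n (X i x))\<^sup>2)"
      by (intro exI allI impI trig_poly_lower_bound lam g)
  qed
qed

end

subsection \<open>The comparison of second moments\<close>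

text \<open>A combination of two standardized coordinates is, up to a constant, a combination of the
  coordinates themselves, hence Gaussian, and its mean and variance determine its characteristic
  function.\<close>

lemma gaussian_family_std_coord:
  fixes P :: "(real^'d) measure"
  assumes P: "prob_space P" and sets_P: "sets P = sets borel"
    and var: "\<And>i. prob_space.variance P (\<lambda>x. x $ i) > 0"
    and biv: "\<And>i j. bivariate_gaussian P (\<lambda>x. x $ i) (\<lambda>x. x $ j)"
  shows "gaussian_family P (std_coord P) (\<lambda>i j. std_cov P $ i $ j)"
proof -
  interpret prob_space P by fact
  note [measurable_cong] = sets_P
  have coord [measurable]: "(\<lambda>x. x $ i) \<in> borel_measurable P" for i
    by (simp add: measurable_cong_sets[OF sets_P refl] borel_measurable_continuous_onI continuous_intros)
  define m where "m i = expectation (\<lambda>y. y $ i)" for i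
  define s where "s i = sqrt (variance (\<lambda>y. y $ i))" for i
  have s: "s i > 0" "(s i)\<^sup>2 = variance (\<lambda>y. y $ i)" for i
    using var[of i] by (auto simp: s_def less_imp_le)
  have X: "std_coord P i x = (x $ i - m i) / s i" for i x
    by (simp add: std_coord_def m_def s_def)
  \<comment> \<open>The coefficients 1 and 0 make each single coordinate Gaussian, hence square
    integrable.\<close>
  have "gaussian_rv P (\<lambda>x. 1 * x $ i + 0 * x $ i)" for i
    using biv[of i i] unfolding bivariate_gaussian_def by blast
  then have int2: "integrable P (\<lambda>x. (x $ i)\<^sup>2)" for i
    using gaussian_rv_square_integrable[OF coord[of i]] by simp
  have int1: "integrable P (\<lambda>x. x $ i)" for i
    by (rule square_integrable_imp_integrable[OF coord int2])
  have intX1: "integrable P (std_coord P i)" for i unfolding X[abs_def] using int1 by simp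
  have EX: "expectation (std_coord P i) = 0" for i
    unfolding X[abs_def] using int1 by (simp add: m_def prob_space)
  have mX [measurable]: "std_coord P i \<in> borel_measurable P" for i unfolding X[abs_def] by measurable
  have intX2: "integrable P (\<lambda>x. (std_coord P i x)\<^sup>2)" for i
    unfolding X power_divide by (intro integrable_divide integrable_power2_diff int2) auto
  have EX2: "expectation (\<lambda>x. (std_coord P i x)\<^sup>2) = 1" for i
    using var[of i] unfolding X power_divide s(2) m_def by simp
  have intXX: "integrable P (\<lambda>x. std_coord P i x * std_coord P j x)" for i j
    by (intro integrable_mult_square_integrable intX2) auto
  have char: "(\<integral>x. cis (a * std_coord P i x - b * std_coord P j x) \<partial>P)
      = of_real (exp (- (a\<^sup>2 - 2 * std_cov P $ i $ j * a * b + b\<^sup>2) / 2))" for a b i j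
  proof -
    \<comment> \<open>\<open>Z\<close> has exactly the form required by
      \<open>bivariate_gaussian\<close>; the constant \<open>c\<close> does the centring.\<close>
    define Z where "Z x = (a / s i) * x $ i + (- b / s j) * x $ j" for x
    define c where "c = - (a / s i) * m i + (b / s j) * m j"
    have Z: "Z x + c = a * std_coord P i x - b * std_coord P j x" for x
      unfolding Z_def c_def X using s(1)[of i] s(1)[of j] by (simp add: field_simps)
    have [measurable]: "Z \<in> borel_measurable P" unfolding Z_def by measurable
    have "gaussian_rv P Z"
      unfolding Z_def using biv[of i j] unfolding bivariate_gaussian_def by blast
    then have cf: "(\<integral>x. cis (Z x + c) \<partial>P) = cis (expectation Z + c) * of_real (exp (- variance Z / 2))"
      by (intro gaussian_rv_char) auto
    have EZ: "expectation Z = - c"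
    proof -
      have "expectation Z = expectation (\<lambda>x. (a * std_coord P i x - b * std_coord P j x) - c)"
        by (intro Bochner_Integration.integral_cong) (auto simp flip: Z)
      also have "\<dots> = - c" by (simp add: intX1 EX prob_space)
      finally show ?thesis .
    qed
    have V: "variance Z = a\<^sup>2 - 2 * std_cov P $ i $ j * a * b + b\<^sup>2"
    proof -
      have "variance Z = expectation (\<lambda>x. (a * std_coord P i x - b * std_coord P j x)\<^sup>2)"
        unfolding EZ by (simp flip: Z)
      also have "(\<lambda>x. (a * std_coord P i x - b * std_coord P j x)\<^sup>2)
          = (\<lambda>x. a\<^sup>2 * (std_coord P i x)\<^sup>2 - 2 * a * b * (std_coord P i x * std_coord P j x) + b\<^sup>2 * (std_coord P j x)\<^sup>2)"
        by (auto simp: power2_eq_square algebra_simps)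
      also have "expectation \<dots> = a\<^sup>2 - 2 * a * b * std_cov P $ i $ j + b\<^sup>2"
        by (simp add: intX2 intXX EX2 std_cov_def)
      finally show ?thesis by (simp add: mult_ac)
    qed
    show ?thesis using cf[unfolded V, unfolded EZ] unfolding Z by simp
  qed
  show ?thesis
    by unfold_locales (auto intro: intX2 simp: EX2 std_cov_def char[unfolded std_cov_def])
qed

lemma inner_matrix_vector_mult:
  fixes A :: "real^'n^'n"
  shows "v \<bullet> (A *v v) = (\<Sum>i\<in>UNIV. \<Sum>j\<in>UNIV. A $ i $ j * v $ i * v $ j)"
  by (simp add: inner_vec_def matrix_vector_mult_def sum_distrib_left mult_ac)

lemma ratio0_le:
  assumes "0 \<le> A" "0 \<le> B" "0 \<le> r" "B \<le> r * A"
  shows "ratio0 (ennreal B) (ennreal A) \<le> ennreal r"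
proof (cases "A = 0")
  case True
  \<comment> \<open>Here \<open>B\<close> vanishes as well, and the convention 0/0 = 0
    applies.\<close>
  then show ?thesis using assms by (simp add: ratio0_def)
next
  case False
  then have A: "A > 0" using assms by simp
  then have "ratio0 (ennreal B) (ennreal A) = ennreal (B / A)"
    using assms by (simp add: ratio0_def divide_ennreal)
  also have "\<dots> \<le> ennreal r" using assms A by (intro ennreal_leI) (simp add: field_simps)
  finally show ?thesis .
qed

text \<open>Both second moments are compared with the squared mean \<open>?M\<close> and the sum
  \<open>?V\<close> of the variances of the summands. These depend on the marginals only and so
  agree for \<open>P\<close> and \<open>Q\<close>.\<close>

lemma additive_second_moment_comparison:
  fixes P Q :: "(real^'d) measure"
  assumes P: "prob_space P" and Q: "prob_space Q"
    and sets_P: "sets P = sets borel" and sets_Q: "sets Q = sets borel"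
    and marg: "\<And>i. distr P borel (\<lambda>x. x $ i) = distr Q borel (\<lambda>x. x $ i)"
    and var: "\<And>i. prob_space.variance P (\<lambda>x. x $ i) > 0"
    and biv: "\<And>i j. bivariate_gaussian P (\<lambda>x. x $ i) (\<lambda>x. x $ j)"
    and pos: "0 < lam" "lam \<le> 1"
    and lam: "\<And>v. lam * (\<Sum>i\<in>UNIV. (v i)\<^sup>2) \<le> (\<Sum>i\<in>UNIV. \<Sum>j\<in>UNIV. std_cov P $ i $ j * v i * v j)"
    and h [measurable]: "\<And>i. h i \<in> borel_measurable borel"
    and int: "\<And>i. integrable P (\<lambda>x. (h i (x $ i))\<^sup>2)"
  shows "integrable P (\<lambda>x. (\<Sum>i\<in>UNIV. h i (x $ i))\<^sup>2)"
    and "integrable Q (\<lambda>x. (\<Sum>i\<in>UNIV. h i (x $ i))\<^sup>2)"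
    and "(\<integral>x. (\<Sum>i\<in>UNIV. h i (x $ i))\<^sup>2 \<partial>Q) \<le> real CARD('d) / lam * (\<integral>x. (\<Sum>i\<in>UNIV. h i (x $ i))\<^sup>2 \<partial>P)"
proof -
  interpret P: prob_space P by fact
  interpret Q: prob_space Q by fact
  interpret gaussian_family P "std_coord P" "\<lambda>i j. std_cov P $ i $ j"
    by (rule gaussian_family_std_coord) fact+
  note [measurable_cong] = sets_P sets_Q
  have [measurable]: "(\<lambda>x. x $ i) \<in> borel_measurable P" "(\<lambda>x. x $ i) \<in> borel_measurable Q" for i
    by (simp_all add: measurable_cong_sets[OF sets_P refl] measurable_cong_sets[OF sets_Q refl]
        borel_measurable_continuous_onI continuous_intros)
  have transfer_integral: "(\<integral>x. f (x $ i) \<partial>P) = (\<integral>x. f (x $ i) \<partial>Q)"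
    if "f \<in> borel_measurable borel" for f :: "real \<Rightarrow> real" and i
    using integral_distr[of "\<lambda>x. x $ i" P borel f] integral_distr[of "\<lambda>x. x $ i" Q borel f] that marg[of i]
    by simp
  have transfer_integrable: "integrable P (\<lambda>x. f (x $ i)) = integrable Q (\<lambda>x. f (x $ i))"
    if "f \<in> borel_measurable borel" for f :: "real \<Rightarrow> real" and i
    using integrable_distr_eq[of "\<lambda>x. x $ i" P borel f] integrable_distr_eq[of "\<lambda>x. x $ i" Q borel f] that marg[of i]
    by simp
  have intQ: "integrable Q (\<lambda>x. (h i (x $ i))\<^sup>2)" for i
    using int[of i] transfer_integrable[of "\<lambda>y. (h i y)\<^sup>2" i] by simp
  show intHP: "integrable P (\<lambda>x. (\<Sum>i\<in>UNIV. h i (x $ i))\<^sup>2)"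
    by (intro P.integrable_sum_power2 int) measurable
  show intHQ: "integrable Q (\<lambda>x. (\<Sum>i\<in>UNIV. h i (x $ i))\<^sup>2)"
    by (intro Q.integrable_sum_power2 intQ) measurable
  define m where "m i = P.expectation (\<lambda>x. h i (x $ i))" for i
  define v where "v i = P.expectation (\<lambda>x. (h i (x $ i))\<^sup>2) - (m i)\<^sup>2" for i
  have int1P: "integrable P (\<lambda>x. h i (x $ i))" for i
    by (rule P.square_integrable_imp_integrable[OF _ int]) measurable
  have int1Q: "integrable Q (\<lambda>x. h i (x $ i))" for i
    by (rule Q.square_integrable_imp_integrable[OF _ intQ]) measurable
  have mQ: "Q.expectation (\<lambda>x. h i (x $ i)) = m i" for i
    unfolding m_def using transfer_integral[of "h i" i] by simp
  have vQ: "Q.expectation (\<lambda>x. (h i (x $ i) - m i)\<^sup>2) = v i" for i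
    using Q.variance_eq[OF int1Q intQ, of i] transfer_integral[of "\<lambda>y. (h i y)\<^sup>2" i]
    by (simp add: mQ v_def)
  let ?M = "(\<Sum>i\<in>UNIV. m i)\<^sup>2" and ?V = "\<Sum>i\<in>UNIV. v i"

  have lower: "?M + lam * ?V \<le> P.expectation (\<lambda>x. (\<Sum>i\<in>UNIV. h i (x $ i))\<^sup>2)"
  proof -
    \<comment> \<open>\<open>a i\<close> and \<open>s i\<close> undo the standardization, turning
      \<open>h i\<close> into a function of \<open>std_coord P i\<close>.\<close>
    define a where "a i = P.expectation (\<lambda>y. y $ i)" for i
    define s where "s i = sqrt (P.variance (\<lambda>y. y $ i))" for i
    have "s i > 0" for i using var[of i] by (simp add: s_def)
    then have eq: "h i (a i + s i * std_coord P i x) = h i (x $ i)" for i x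
      by (simp add: std_coord_def a_def s_def less_imp_neq[symmetric])
    have "P.expectation (\<lambda>x. \<Sum>i\<in>UNIV. h i (x $ i)) = (\<Sum>i\<in>UNIV. m i)"
      by (simp add: int1P m_def)
    then show ?thesis
      using additive_lower_bound[of lam "\<lambda>i y. h i (a i + s i * y)"] lam int
      by (simp add: eq v_def m_def)
  qed
  have upper: "Q.expectation (\<lambda>x. (\<Sum>i\<in>UNIV. h i (x $ i))\<^sup>2) \<le> ?M + real CARD('d) * ?V"
  proof -
    have "Q.expectation (\<lambda>x. \<Sum>i\<in>UNIV. h i (x $ i)) = (\<Sum>i\<in>UNIV. m i)"
      by (simp add: int1Q mQ)
    moreover have "integrable Q (\<lambda>x. \<Sum>i\<in>UNIV. h i (x $ i))" using int1Q by simp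
    ultimately have "Q.expectation (\<lambda>x. (\<Sum>i\<in>UNIV. h i (x $ i))\<^sup>2)
        = ?M + Q.expectation (\<lambda>x. ((\<Sum>i\<in>UNIV. h i (x $ i)) - (\<Sum>i\<in>UNIV. m i))\<^sup>2)"
      using Q.variance_eq[OF _ intHQ] by simp
    \<comment> \<open>The summands are centred first, so that the dimension multiplies variances
      only and not the squared mean.\<close>
    also have "Q.expectation (\<lambda>x. ((\<Sum>i\<in>UNIV. h i (x $ i)) - (\<Sum>i\<in>UNIV. m i))\<^sup>2) \<le> real CARD('d) * ?V"
    proof -
      have "integrable Q (\<lambda>x. (h i (x $ i) - m i)\<^sup>2)" for i
        by (intro Q.integrable_power2_diff intQ) auto
      then show ?thesis
        using Q.integrable_sum_power2(2)[of "\<lambda>i x. h i (x $ i) - m i"] by (simp add: sum_subtractf vQ)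
    qed
    finally show ?thesis by simp
  qed
  let ?r = "real CARD('d) / lam"
  have r: "1 \<le> ?r"
  proof -
    have "1 \<le> real CARD('d)" by (simp add: Suc_leI)
    then have "lam \<le> real CARD('d)" using pos by linarith
    then show ?thesis using pos by simp
  qed
  \<comment> \<open>The squared mean has factor 1 on both sides; \<open>1 \<le> ?r\<close> lets it
    be absorbed.\<close>
  have "?M + real CARD('d) * ?V \<le> ?r * ?M + real CARD('d) * ?V"
    using mult_right_mono[OF r, of ?M] by simp
  also have "\<dots> = ?r * (?M + lam * ?V)" using pos by (simp add: field_simps)
  also have "\<dots> \<le> ?r * P.expectation (\<lambda>x. (\<Sum>i\<in>UNIV. h i (x $ i))\<^sup>2)"
    using lower r by (intro mult_left_mono) auto
  finally show "Q.expectation (\<lambda>x. (\<Sum>i\<in>UNIV. h i (x $ i))\<^sup>2) \<le> ?r * P.expectation (\<lambda>x. (\<Sum>i\<in>UNIV. h i (x $ i))\<^sup>2)"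
    using upper by simp
qed

section \<open>From second moments to the supremum \<open>tau\<close>\<close>

theorem mainTheorem4:
  fixes P Q :: "(real^'d) measure"
  assumes "prob_space P" and "prob_space Q"
    and "sets P = sets borel" and "sets Q = sets borel"
    and "\<And>i. distr P borel (\<lambda>x. x $ i) = distr Q borel (\<lambda>x. x $ i)"
    and "\<And>i. prob_space.variance P (\<lambda>x. x $ i) > 0"
    and "\<And>i j. bivariate_gaussian P (\<lambda>x. x $ i) (\<lambda>x. x $ j)"
    and "\<And>i j. bivariate_gaussian Q (\<lambda>x. x $ i) (\<lambda>x. x $ j)"
  shows "tau P Q (additive_class P) \<le>
           (if lambda_min (std_cov P) = 0 then \<infinity>
            else ennreal (real CARD('d) / lambda_min (std_cov P)))"
proof (cases "lambda_min (std_cov P) = 0")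
  case False
  interpret P: prob_space P by fact
  interpret gaussian_family P "std_coord P" "\<lambda>i j. std_cov P $ i $ j"
    by (rule gaussian_family_std_coord) fact+
  note [measurable_cong] = assms(3)
  have [measurable]: "(\<lambda>x. x $ i) \<in> borel_measurable P" for i
    by (simp add: measurable_cong_sets[OF assms(3) refl] borel_measurable_continuous_onI continuous_intros)
  define lam where "lam = lambda_min (std_cov P)"
  have sym: "transpose (std_cov P) = std_cov P"
    by (simp add: transpose_def std_cov_def vec_eq_iff mult.commute)
  have lam: "lam * (\<Sum>i\<in>UNIV. (v i)\<^sup>2) \<le> (\<Sum>i\<in>UNIV. \<Sum>j\<in>UNIV. std_cov P $ i $ j * v i * v j)" for v
    using lambda_min_rayleigh[OF sym, of "\<chi> i. v i"]
    by (simp add: lam_def inner_matrix_vector_mult) (simp add: inner_vec_def power2_eq_square)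
  have "0 < lam"
  proof -
    obtain v where v: "v \<noteq> 0" "std_cov P *v v = lam *\<^sub>R v"
      using lambda_min_eigenvalue[OF sym] by (auto simp: lam_def)
    \<comment> \<open>Schur's theorem with the all-ones matrix, whose form is the square of a sum,
      shows that the correlation matrix is positive semidefinite.\<close>
    have "0 \<le> (\<Sum>i\<in>UNIV. \<Sum>j\<in>UNIV. std_cov P $ i $ j * 1 * v $ i * v $ j)"
      by (rule schur_product) (simp add: sum_product[symmetric])
    then have "0 \<le> v \<bullet> (std_cov P *v v)" by (simp add: inner_matrix_vector_mult)
    then have "0 \<le> lam * (v \<bullet> v)" by (simp add: v)
    then have "0 \<le> lam" using v(1) by (metis inner_gt_zero_iff zero_le_mult_iff not_le)
    then show ?thesis using False by (simp add: lam_def)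
  qed
  moreover have "lam \<le> 1"
  proof -
    fix k :: 'd
    \<comment> \<open>A basis vector as test vector picks out a diagonal entry, which is 1.\<close>
    show ?thesis using lam[of "\<lambda>i. if i = k then 1 else 0"]
      by (simp add: if_distrib[of "\<lambda>z. z\<^sup>2"] if_distrib[of "\<lambda>z. _ * z"] cong: if_cong)
  qed
  ultimately have r: "0 < lam" "lam \<le> 1" "0 \<le> real CARD('d) / lam" by auto
  have "ratio0 (\<integral>\<^sup>+ x. ennreal ((F x - G x)\<^sup>2) \<partial>Q) (\<integral>\<^sup>+ x. ennreal ((F x - G x)\<^sup>2) \<partial>P) \<le> ennreal (real CARD('d) / lam)"
    if F: "F \<in> additive_class P" and G: "G \<in> additive_class P" for F G
  proof -
    have square_integrable: "integrable P (\<lambda>x. (f (x $ i))\<^sup>2)"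
      if [measurable]: "f \<in> borel_measurable borel" and "(\<integral>\<^sup>+ x. ennreal ((f (x $ i))\<^sup>2) \<partial>P) < \<infinity>"
      for f :: "real \<Rightarrow> real" and i
      by (rule integrableI_bounded) (use that in auto)
    obtain f where f: "F = (\<lambda>x. \<Sum>i\<in>UNIV. f i (x $ i))" and f_meas [measurable]: "\<And>i. f i \<in> borel_measurable borel"
      and "\<And>i. integrable P (\<lambda>x. (f i (x $ i))\<^sup>2)"
      using F square_integrable unfolding additive_class_def by blast
    moreover obtain g where g: "G = (\<lambda>x. \<Sum>i\<in>UNIV. g i (x $ i))" and g_meas [measurable]: "\<And>i. g i \<in> borel_measurable borel"
      and "\<And>i. integrable P (\<lambda>x. (g i (x $ i))\<^sup>2)"
      using G square_integrable unfolding additive_class_def by blast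
    ultimately have int: "integrable P (\<lambda>x. (f i (x $ i) - g i (x $ i))\<^sup>2)" for i
      by (intro P.integrable_power2_diff) auto
    note cmp = additive_second_moment_comparison[OF assms(1-7) r(1,2) lam _ int, simplified]
    \<comment> \<open>The difference of two additive functions is additive, so the comparison for a
      single sum covers every pair in the supremum.\<close>
    have FG: "F x - G x = (\<Sum>i\<in>UNIV. f i (x $ i) - g i (x $ i))" for x by (simp add: f g sum_subtractf)
    have "ratio0 (ennreal (\<integral>x. (F x - G x)\<^sup>2 \<partial>Q)) (ennreal (\<integral>x. (F x - G x)\<^sup>2 \<partial>P)) \<le> ennreal (real CARD('d) / lam)"
      by (intro ratio0_le r) (use cmp(3) in \<open>simp_all add: FG\<close>)
    then show ?thesis
      using cmp(1,2) by (simp add: FG nn_integral_eq_integral)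
  qed
  then show ?thesis
    using False by (auto simp: tau_def lam_def intro!: SUP_least)
qed simp

end
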